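(* Let $\mathbb{X}=\mathbb{R}$ and $\mathbb{A}=[0,+\infty)$. Assume that there exists $\alpha^*\in[0,1)$ such that for all $\alpha\in(\alpha^*,1]$: (i) the function $x\mapsto\mathbb{E}[h_\alpha(x-D)]$ is quasiconvex on $\mathbb{R}$; and (ii) $\lim_{x\to-\infty}\mathbb{E}[h_\alpha(x-D)]>K+\inf_{x\in\mathbb{R}}\mathbb{E}[h_\alpha(x-D)]$. Assume also that the function $x\mapsto\mathbb{E}[h_1(x-D)]$ is strictly decreasing on $(-\infty,x^{\min}_1]$. Then $$\lim_{\alpha\uparrow1}u_\alpha(x)=u(x),\qquad x\in\mathbb{R},$$ where $u(x):=\liminf_{\alpha\uparrow1,\,y\to x}u_\alpha(y)$, and the function $u$ is continuous.
   Context: Inventory model with states $x\in\mathbb{R}$ and actions $a\in[0,+\infty)$. Constants $K>0$ (fixed ordering cost), $\bar c>0$ (unit ordering cost). $D_1,D_2,\ldots$ are i.i.d. nonnegative finite random variables, $D$ has the same distribution as $D_1$, $\mathbb{E}[D]<+\infty$, $P(D>0)>0$. The holding/backlog cost function $h:\mathbb{R}\to\mathbb{R}$ is such that $x\mapsto\mathbb{E}[h(x-D)]$ is finite, continuous and nonnegative and $\mathbb{E}[h(x-D)]\to+\infty$ as $|x|\to+\infty$. Dynamics: $x_{t+1}=x_t+a_t-D_{t+1}$. One-step cost: $c(x,a)=K\mathbf{1}_{\{a>0\}}+\bar c a+\mathbb{E}[h(x+a-D)]$. Policies may be randomized and history-dependent; $v_\alpha(x)=\inf_\pi\mathbb{E}_x^\pi[\sum_{t=0}^\infty\alpha^t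 c(x_t,a_t)]$ for $\alpha\in[0,1)$, $m_\alpha:=\inf_{x}v_\alpha(x)$, $u_\alpha(x):=v_\alpha(x)-m_\alpha$ (discounted relative value function). For $\alpha\in(0,1]$: $h_\alpha(x):=h(x)+(1-\alpha)\bar c x+\bar c\,\mathbb{E}[D]$ and $x^{\min}_\alpha:=\min\{\operatorname{arg\,min}_{x\in\mathbb{R}}\mathbb{E}[h_\alpha(x-D)]\}$ (the smallest minimizer). $\liminf_{\alpha\uparrow1,y\to x}u_\alpha(y)$ is the joint lower limit (the infimum of $\liminf_n u_{\alpha_n}(y_n)$ over all sequences $\alpha_n\uparrow1$, $y_n\to x$). A function $f$ on $\mathbb{R}$ is quasiconvex if $f(\lambda x+(1-\lambda)y)\le\max\{f(x),f(y)\}$ for all $x,y$ and $\lambda\in[0,1]$. *)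

theory Defs
  imports "HOL-Probability.Probability"
begin

definition quasiconvex :: "(real \<Rightarrow> real) \<Rightarrow> bool" where
  "quasiconvex f \<longleftrightarrow>
     (\<forall>x y. \<forall>t\<in>{0..1}. f (t * x + (1 - t) * y) \<le> max (f x) (f y))"

(* The demand sequence is D 1, D 2, ...; the value D 0 plays no role. The generic demand D of
   the text is represented by D 1. Integrability of the random variables h (x - D 1) is all that is
   required of h; measurability of h itself is not assumed. *)
locale inventory_model = prob_space M
  for M :: "'w measure" +
  fixes D :: "nat \<Rightarrow> 'w \<Rightarrow> real"
    and K cbar :: real
    and h :: "real \<Rightarrow> real"
  assumes K_pos: "K > 0"
    and cbar_pos: "cbar > 0"
    and D_indep: "indep_vars (\<lambda>_. borel) D {1..}"
    and D_ident: "\<And>t. t \<ge> 1 \<Longrightarrow> distr M borel (D t) = distr M borel (D 1)"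
    and D_nonneg: "\<And>t \<omega>. t \<ge> 1 \<Longrightarrow> \<omega> \<in> space M \<Longrightarrow> D t \<omega> \<ge> 0"
    and D_integrable: "integrable M (D 1)"
    and D_nontrivial: "prob {\<omega> \<in> space M. D 1 \<omega> > 0} > 0"
    and Eh_integrable: "\<And>x. integrable M (\<lambda>\<omega>. h (x - D 1 \<omega>))"
    and Eh_continuous: "continuous_on UNIV (\<lambda>x. expectation (\<lambda>\<omega>. h (x - D 1 \<omega>)))"
    and Eh_nonneg: "\<And>x. expectation (\<lambda>\<omega>. h (x - D 1 \<omega>)) \<ge> 0"
    and Eh_coercive: "filterlim (\<lambda>x. expectation (\<lambda>\<omega>. h (x - D 1 \<omega>))) at_top at_infinity"
begin

definition cost :: "real \<Rightarrow> real \<Rightarrow> real" where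
  "cost x a = (if a > 0 then K else 0) + cbar * a + expectation (\<lambda>\<omega>. h (x + a - D 1 \<omega>))"

definition h_disc :: "real \<Rightarrow> real \<Rightarrow> real" where
  "h_disc \<alpha> x = h x + (1 - \<alpha>) * cbar * x + cbar * expectation (D 1)"

definition Eh_disc :: "real \<Rightarrow> real \<Rightarrow> real" where
  "Eh_disc \<alpha> x = expectation (\<lambda>\<omega>. h_disc \<alpha> (x - D 1 \<omega>))"

definition x_min :: "real \<Rightarrow> real" where
  "x_min \<alpha> = (LEAST x. is_arg_min (Eh_disc \<alpha>) (\<lambda>_. True) x)"

abbreviation action_space :: "real measure" where
  "action_space \<equiv> restrict_space borel {0..}"

abbreviation stage_space :: "(real \<times> real) measure" where
  "stage_space \<equiv> borel \<Otimes>\<^sub>M action_space"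

(* pi t w x is the law of the action a_t, given the state x = x_t and the past
   w = ((x_0, a_0), ..., (x_(t-1), a_(t-1))). *)
definition policies :: "(nat \<Rightarrow> (nat \<Rightarrow> real \<times> real) \<Rightarrow> real \<Rightarrow> real measure) set" where
  "policies = {\<pi>. \<forall>t. (\<lambda>(\<omega>, x). \<pi> t \<omega> x)
     \<in> (PiM {0..<t} (\<lambda>_. stage_space) \<Otimes>\<^sub>M borel) \<rightarrow>\<^sub>M prob_algebra action_space}"

(* Law of x_t: the point mass at the initial state x0 for t = 0, and the law of
   x_(t-1) + a_(t-1) - D_t, given the past, for t > 0. *)
definition state_law :: "real \<Rightarrow> nat \<Rightarrow> (nat \<Rightarrow> real \<times> real) \<Rightarrow> real measure" where
  "state_law x0 t \<omega> = (case t of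
       0 \<Rightarrow> return borel x0
     | Suc n \<Rightarrow> distr M borel (\<lambda>\<xi>. fst (\<omega> n) + snd (\<omega> n) - D (Suc n) \<xi>))"

(* Law of (x_t, a_t) given the past. *)
definition stage_law ::
    "(nat \<Rightarrow> (nat \<Rightarrow> real \<times> real) \<Rightarrow> real \<Rightarrow> real measure) \<Rightarrow> real
      \<Rightarrow> nat \<Rightarrow> (nat \<Rightarrow> real \<times> real) \<Rightarrow> (real \<times> real) measure" where
  "stage_law \<pi> x0 t \<omega> =
     state_law x0 t \<omega> \<bind> (\<lambda>x. \<pi> t \<omega> x \<bind> (\<lambda>a. return stage_space (x, a)))"

(* The measure on trajectories ((x_0, a_0), (x_1, a_1), ...) that the Ionescu-Tulcea theorem
   builds from the stage laws. *)
definition strategic_measure ::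
    "(nat \<Rightarrow> (nat \<Rightarrow> real \<times> real) \<Rightarrow> real \<Rightarrow> real measure) \<Rightarrow> real
      \<Rightarrow> (nat \<Rightarrow> real \<times> real) measure" where
  "strategic_measure \<pi> x0 =
     projective_family.lim UNIV
       (Ionescu_Tulcea.CI (stage_law \<pi> x0) (\<lambda>_. stage_space)) (\<lambda>_. stage_space)"

(* One-step costs are nonnegative by Eh_nonneg, so that ennreal does not truncate. *)
definition disc_cost ::
    "real \<Rightarrow> (nat \<Rightarrow> (nat \<Rightarrow> real \<times> real) \<Rightarrow> real \<Rightarrow> real measure) \<Rightarrow> real \<Rightarrow> ennreal" where
  "disc_cost \<alpha> \<pi> x =
     (\<integral>\<^sup>+ \<omega>. (\<Sum>t. ennreal (\<alpha> ^ t * cost (fst (\<omega> t)) (snd (\<omega> t)))) \<partial>strategic_measure \<pi> x)"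

definition v :: "real \<Rightarrow> real \<Rightarrow> ennreal" where
  "v \<alpha> x = (INF \<pi>\<in>policies. disc_cost \<alpha> \<pi> x)"

definition m :: "real \<Rightarrow> ennreal" where
  "m \<alpha> = (INF x. v \<alpha> x)"

definition u_disc :: "real \<Rightarrow> real \<Rightarrow> ereal" where
  "u_disc \<alpha> x = enn2ereal (v \<alpha> x) - enn2ereal (m \<alpha>)"

definition u :: "real \<Rightarrow> ereal" where
  "u x = (INF (\<alpha>, y) \<in> {(\<alpha>, y). (\<forall>n. \<alpha> n \<in> {0..<1}) \<and> incseq \<alpha> \<and> \<alpha> \<longlonglongrightarrow> 1 \<and> y \<longlonglongrightarrow> x}.
            liminf (\<lambda>n. u_disc (\<alpha> n) (y n)))"

lemma D_measurable: "t \<ge> 1 \<Longrightarrow> D t \<in> borel_measurable M"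
  using D_indep by (auto simp: indep_vars_def2)

lemma state_law_measurable:
  "state_law x0 t \<in> PiM {0..<t} (\<lambda>_. stage_space) \<rightarrow>\<^sub>M prob_algebra borel"
proof (cases t)
  case 0
  then show ?thesis
    by (simp add: state_law_def[abs_def] space_prob_algebra prob_space_return)
next
  case (Suc n)
  have [measurable]: "D (Suc n) \<in> borel_measurable M" by (rule D_measurable) simp
  have comp[measurable]: "(\<lambda>\<omega>. \<omega> n) \<in> PiM {0..<t} (\<lambda>_. stage_space) \<rightarrow>\<^sub>M stage_space"
    using Suc by (intro measurable_component_singleton) auto
  have [measurable]: "(\<lambda>a. a) \<in> borel_measurable action_space"
    by (rule measurable_restrict_space1) simp
  have [measurable]: "snd \<in> borel_measurable stage_space"
    using measurable_compose[OF measurable_snd[of borel action_space]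
        \<open>(\<lambda>a. a) \<in> borel_measurable action_space\<close>] by simp
  have "(\<lambda>\<omega>. distr M borel (\<lambda>\<xi>. fst (\<omega> n) + snd (\<omega> n) - D (Suc n) \<xi>))
      \<in> PiM {0..<t} (\<lambda>_. stage_space) \<rightarrow>\<^sub>M prob_algebra borel"
  proof (rule measurable_distr_prob_space2)
    show "(\<lambda>_. M) \<in> PiM {0..<t} (\<lambda>_. stage_space) \<rightarrow>\<^sub>M prob_algebra M"
      by (auto simp: space_prob_algebra prob_space_axioms intro!: measurable_const)
  qed measurable
  then show ?thesis by (simp add: Suc state_law_def[abs_def])
qed

lemma stage_law_measurable:
  assumes "\<pi> \<in> policies"
  shows "stage_law \<pi> x0 t \<in> PiM {0..<t} (\<lambda>_. stage_space) \<rightarrow>\<^sub>M prob_algebra stage_space"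
proof -
  have pi: "(\<lambda>(\<omega>, x). \<pi> t \<omega> x)
      \<in> (PiM {0..<t} (\<lambda>_. stage_space) \<Otimes>\<^sub>M borel) \<rightarrow>\<^sub>M prob_algebra action_space"
    using assms by (auto simp: policies_def)
  have "(\<lambda>p. case_prod (\<pi> t) p \<bind> (\<lambda>a. return stage_space (snd p, a)))
      \<in> (PiM {0..<t} (\<lambda>_. stage_space) \<Otimes>\<^sub>M borel) \<rightarrow>\<^sub>M prob_algebra stage_space"
    by (rule measurable_bind_prob_space2[OF pi]) measurable
  then have "(\<lambda>\<omega>. state_law x0 t \<omega> \<bind> (\<lambda>x. \<pi> t \<omega> x \<bind> (\<lambda>a. return stage_space (x, a))))
      \<in> PiM {0..<t} (\<lambda>_. stage_space) \<rightarrow>\<^sub>M prob_algebra stage_space"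
    by (intro measurable_bind_prob_space2[OF state_law_measurable])
      (simp add: case_prod_beta)
  then show ?thesis by (simp add: stage_law_def[abs_def])
qed

lemma Ionescu_Tulcea_stage_law:
  assumes "\<pi> \<in> policies"
  shows "Ionescu_Tulcea (stage_law \<pi> x0) (\<lambda>_. stage_space)"
proof (rule Ionescu_Tulcea.intro)
  show "stage_law \<pi> x0 i \<in> PiM {0..<i} (\<lambda>_. stage_space) \<rightarrow>\<^sub>M subprob_algebra stage_space" for i
    by (rule measurable_prob_algebraD[OF stage_law_measurable[OF assms]])
  show "prob_space (stage_law \<pi> x0 i \<omega>)" if "\<omega> \<in> space (PiM {0..<i} (\<lambda>_. stage_space))" for i \<omega>
    using measurable_space[OF stage_law_measurable[OF assms] that]
    by (simp add: space_prob_algebra)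
qed

end

end

theory Submission
  imports Defs
begin

text \<open>
  Write \<open>G\<^sub>\<alpha>(x) = E h\<^sub>\<alpha>(x - D)\<close>. For a level \<open>g\<close> let \<open>\<psi>\<close> be \<open>G\<^sub>\<alpha> - g\<close> to the right of the leftmost point
  with \<open>G\<^sub>\<alpha> \<le> g\<close> and \<open>0\<close> to the left of it, and let \<open>\<phi>\<close> be the solution of
  \<open>\<phi>(x) = \<psi>(x) + \<alpha> E \<phi>(x - D)\<close> that vanishes near \<open>-\<infinity>\<close>. By the intermediate value theorem and
  hypothesis (ii) there is a level \<open>g\<^sub>\<alpha>\<close> for which \<open>min \<phi> = -K\<close>. Quasiconvexity then gives
  \<open>\<phi>(x) \<le> K + \<phi>(y)\<close> for \<open>x \<le> y\<close>, so that for \<open>\<alpha> < 1\<close> the function \<open>\<phi>(x) + g\<^sub>\<alpha>/(1 - \<alpha>) - c x\<close> satisfies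
  the optimality equation; it is the value function, attained by an \<open>(s, S)\<close> policy.

  All of this except the last step makes sense for \<open>\<alpha> = 1\<close> too. With the weight \<open>exp x\<close> the operator
  \<open>f \<mapsto> E f(\<cdot> - D)\<close> is a contraction with factor \<open>E exp(-D) < 1\<close>, hence \<open>\<phi>\<close> depends continuously on
  \<open>(\<alpha>, g)\<close> up to \<open>\<alpha> = 1\<close>, locally uniformly in \<open>x\<close>. Since \<open>min \<phi>\<close> is strictly decreasing in \<open>g\<close>, it
  follows that \<open>g\<^sub>\<alpha> \<rightarrow> g\<^sub>1\<close>. Therefore the relative value functions converge locally uniformly to a
  continuous function, which has to be their joint lower limit.
\<close>

section \<open>Marginals of the strategic measure\<close>

context Ionescu_Tulcea
begin

text \<open>The measure on \<open>Suc n\<close> stages is \<open>C 0 n\<close> bound with the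
  extension kernel \<open>eP n\<close>, and a function of the last coordinate sees only
  \<open>P n\<close>.\<close>

lemma nn_integral_C_Suc:
  assumes f: "f \<in> borel_measurable (M n)"
  shows "(\<integral>\<^sup>+\<omega>. f (\<omega> n) \<partial>C 0 (Suc n) (\<lambda>_. undefined)) =
    (\<integral>\<^sup>+\<omega>. (\<integral>\<^sup>+z. f z \<partial>P n \<omega>) \<partial>C 0 n (\<lambda>_. undefined))"
proof -
  let ?C = "C 0 n (\<lambda>_. undefined)"
  have sp: "space ?C = space (PiM {0..<n} M)" "sets ?C = sets (PiM {0..<n} M)"
    using space_C[of "\<lambda>_. undefined" 0 n] sets_C[of "\<lambda>_. undefined" 0 n] by auto
  have fn: "(\<lambda>\<omega>. f (\<omega> n)) \<in> borel_measurable (PiM {0..<Suc n} M)"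
    by (rule measurable_compose[OF _ f, of "\<lambda>\<omega>. \<omega> n"]) simp
  have "(\<integral>\<^sup>+\<omega>. f (\<omega> n) \<partial>C 0 (Suc n) (\<lambda>_. undefined)) = (\<integral>\<^sup>+\<omega>. f (\<omega> n) \<partial>(?C \<bind> eP n))"
    by simp
  also have "\<dots> = (\<integral>\<^sup>+\<omega>. (\<integral>\<^sup>+\<omega>'. f (\<omega>' n) \<partial>eP n \<omega>) \<partial>?C)"
    using measurable_eP[of n] by (intro nn_integral_bind[OF fn]) (simp add: measurable_cong_sets[OF sp(2) refl])
  also have "\<dots> = (\<integral>\<^sup>+\<omega>. (\<integral>\<^sup>+z. f z \<partial>P n \<omega>) \<partial>?C)"
    by (intro nn_integral_cong) (simp add: sp nn_integral_eP[OF _ fn])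
  finally show ?thesis .
qed

text \<open>On an initial segment the projective family is \<open>C 0 n\<close> itself, because
  \<open>up_to {0..<n}\<close> equals \<open>n\<close>; the limit has it as marginal.\<close>

lemma nn_integral_lim_restrict:
  assumes f: "f \<in> borel_measurable (PiM {0..<n} M)"
  shows "(\<integral>\<^sup>+\<omega>. f (restrict \<omega> {0..<n}) \<partial>PF.lim) = (\<integral>\<^sup>+\<omega>. f \<omega> \<partial>C 0 n (\<lambda>_. undefined))"
proof -
  have "up_to {0..<n} = n"
  proof (rule antisym)
    show "up_to {0..<n} \<le> n" by (simp add: up_to_iff)
    show "n \<le> up_to {0..<n}"
      using up_to[of "{0..<n}"] by (auto simp: ivl_subset)
  qed
  then have "CI {0..<n} = C 0 n (\<lambda>_. undefined)"
    unfolding CI_def using distr_C[of n n "\<lambda>_. undefined" 0] by simp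
  then have "(\<integral>\<^sup>+\<omega>. f \<omega> \<partial>C 0 n (\<lambda>_. undefined)) =
      (\<integral>\<^sup>+\<omega>. f \<omega> \<partial>distr PF.lim (PiM {0..<n} M) (\<lambda>\<omega>. restrict \<omega> {0..<n}))"
    by (simp add: distr_lim)
  also have "\<dots> = (\<integral>\<^sup>+\<omega>. f (restrict \<omega> {0..<n}) \<partial>PF.lim)"
    by (rule nn_integral_distr)
      (use f in \<open>auto intro: measurable_restrict_subset simp: measurable_cong_sets[OF PF.sets_lim refl]\<close>)
  finally show ?thesis ..
qed

lemma nn_integral_lim_component:
  assumes f: "f \<in> borel_measurable (M n)"
  shows "(\<integral>\<^sup>+\<omega>. f (\<omega> n) \<partial>PF.lim) = (\<integral>\<^sup>+\<omega>. (\<integral>\<^sup>+z. f z \<partial>P n \<omega>) \<partial>C 0 n (\<lambda>_. undefined))"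
proof -
  have fn: "(\<lambda>\<omega>. f (\<omega> n)) \<in> borel_measurable (PiM {0..<Suc n} M)"
    by (rule measurable_compose[OF _ f, of "\<lambda>\<omega>. \<omega> n"]) simp
  show ?thesis
    using nn_integral_lim_restrict[OF fn] nn_integral_C_Suc[OF f] by simp
qed

end

context inventory_model
begin

section \<open>Marginals of the inventory process\<close>

lemma sets_strategic_measure:
  assumes "\<pi> \<in> policies"
  shows "sets (strategic_measure \<pi> x0) = sets (PiM UNIV (\<lambda>_. stage_space))"
proof -
  interpret IT: Ionescu_Tulcea "stage_law \<pi> x0" "\<lambda>_. stage_space"
    by (rule Ionescu_Tulcea_stage_law[OF assms])
  show ?thesis unfolding strategic_measure_def by (rule IT.PF.sets_lim)
qed

text \<open>Unfolds the two nested binds of \<open>stage_law\<close>. Freezing the past turns the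
  joint measurability in \<open>policies\<close> into measurability of the kernels integrated
  here.\<close>

lemma nn_integral_stage_law:
  assumes \<pi>: "\<pi> \<in> policies" and f[measurable]: "f \<in> borel_measurable stage_space"
    and \<omega>: "\<omega> \<in> space (PiM {0..<t} (\<lambda>_. stage_space))"
  shows "(\<integral>\<^sup>+z. f z \<partial>stage_law \<pi> x0 t \<omega>) =
    (\<integral>\<^sup>+x. (\<integral>\<^sup>+a. f (x, a) \<partial>\<pi> t \<omega> x) \<partial>state_law x0 t \<omega>)"
proof -
  have pi: "(\<lambda>(\<omega>, x). \<pi> t \<omega> x)
      \<in> (PiM {0..<t} (\<lambda>_. stage_space) \<Otimes>\<^sub>M borel) \<rightarrow>\<^sub>M prob_algebra action_space"
    using \<pi> by (auto simp: policies_def)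
  have pi\<omega>: "(\<lambda>x. \<pi> t \<omega> x) \<in> borel \<rightarrow>\<^sub>M prob_algebra action_space"
    using measurable_compose[OF measurable_Pair1'[OF \<omega>] pi] by simp
  have sl: "state_law x0 t \<omega> \<in> space (prob_algebra borel)"
    using measurable_space[OF state_law_measurable \<omega>] .
  then have sets_sl: "sets (state_law x0 t \<omega>) = sets borel"
    by (simp add: space_prob_algebra)
  have inner: "(\<lambda>x. \<pi> t \<omega> x \<bind> (\<lambda>a. return stage_space (x, a))) \<in> borel \<rightarrow>\<^sub>M prob_algebra stage_space"
    by (rule measurable_bind_prob_space2[OF pi\<omega>]) measurable
  have "(\<integral>\<^sup>+z. f z \<partial>stage_law \<pi> x0 t \<omega>) =
    (\<integral>\<^sup>+x. (\<integral>\<^sup>+z. f z \<partial>(\<pi> t \<omega> x \<bind> (\<lambda>a. return stage_space (x, a)))) \<partial>state_law x0 t \<omega>)"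
    unfolding stage_law_def
    by (rule nn_integral_bind[OF f]) (use measurable_prob_algebraD[OF inner] in \<open>simp add: measurable_cong_sets[OF sets_sl refl]\<close>)
  also have "\<dots> = (\<integral>\<^sup>+x. (\<integral>\<^sup>+a. f (x, a) \<partial>\<pi> t \<omega> x) \<partial>state_law x0 t \<omega>)"
  proof (rule nn_integral_cong)
    fix x :: real
    have "\<pi> t \<omega> x \<in> space (prob_algebra action_space)"
      using measurable_space[OF pi\<omega>] by simp
    then have sp: "sets (\<pi> t \<omega> x) = sets action_space" "space (\<pi> t \<omega> x) = {0..}"
      using sets_eq_imp_space_eq[of "\<pi> t \<omega> x" action_space] by (auto simp: space_prob_algebra space_restrict_space)
    have pr: "Pair x \<in> action_space \<rightarrow>\<^sub>M stage_space" by measurable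
    have "(\<integral>\<^sup>+z. f z \<partial>(\<pi> t \<omega> x \<bind> (\<lambda>a. return stage_space (x, a)))) =
      (\<integral>\<^sup>+a. (\<integral>\<^sup>+z. f z \<partial>return stage_space (x, a)) \<partial>\<pi> t \<omega> x)"
      by (rule nn_integral_bind[OF f]) (simp add: measurable_cong_sets[OF sp(1) refl], measurable)
    also have "\<dots> = (\<integral>\<^sup>+a. f (x, a) \<partial>\<pi> t \<omega> x)"
      by (intro nn_integral_cong nn_integral_return f) (auto simp: sp space_pair_measure space_restrict_space)
    finally show "(\<integral>\<^sup>+z. f z \<partial>(\<pi> t \<omega> x \<bind> (\<lambda>a. return stage_space (x, a)))) =
      (\<integral>\<^sup>+a. f (x, a) \<partial>\<pi> t \<omega> x)" .
  qed
  finally show ?thesis .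
qed

text \<open>Identical distribution replaces the demand of period \<open>Suc t\<close> by
  \<open>D 1\<close>, so that later estimates involve a single random variable.\<close>

lemma nn_integral_state_law_Suc:
  assumes g[measurable]: "g \<in> borel_measurable borel"
  shows "(\<integral>\<^sup>+x. g x \<partial>state_law x0 (Suc t) \<omega>) = (\<integral>\<^sup>+\<xi>. g (fst (\<omega> t) + snd (\<omega> t) - D 1 \<xi>) \<partial>M)"
proof -
  have [measurable]: "D (Suc t) \<in> borel_measurable M" by (rule D_measurable) simp
  have [measurable]: "D 1 \<in> borel_measurable M" by (rule D_measurable) simp
  let ?g = "\<lambda>d. g (fst (\<omega> t) + snd (\<omega> t) - d)"
  have "(\<integral>\<^sup>+x. g x \<partial>state_law x0 (Suc t) \<omega>) = (\<integral>\<^sup>+\<xi>. ?g (D (Suc t) \<xi>) \<partial>M)"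
    unfolding state_law_def by (simp add: nn_integral_distr)
  also have "\<dots> = (\<integral>\<^sup>+d. ?g d \<partial>distr M borel (D (Suc t)))"
    by (rule nn_integral_distr[symmetric]) measurable
  also have "\<dots> = (\<integral>\<^sup>+d. ?g d \<partial>distr M borel (D 1))"
    by (subst D_ident) auto
  also have "\<dots> = (\<integral>\<^sup>+\<xi>. ?g (D 1 \<xi>) \<partial>M)"
    by (rule nn_integral_distr) measurable
  finally show ?thesis .
qed

lemma nn_integral_strategic_component:
  assumes \<pi>: "\<pi> \<in> policies" and f[measurable]: "f \<in> borel_measurable stage_space"
  shows "(\<integral>\<^sup>+\<omega>. f (\<omega> t) \<partial>strategic_measure \<pi> x0) =
    (\<integral>\<^sup>+\<omega>. (\<integral>\<^sup>+x. (\<integral>\<^sup>+a. f (x, a) \<partial>\<pi> t \<omega> x) \<partial>state_law x0 t \<omega>)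
      \<partial>Ionescu_Tulcea.C (stage_law \<pi> x0) (\<lambda>_. stage_space) 0 t (\<lambda>_. undefined))"
proof -
  interpret IT: Ionescu_Tulcea "stage_law \<pi> x0" "\<lambda>_. stage_space"
    by (rule Ionescu_Tulcea_stage_law[OF \<pi>])
  have "space (IT.C 0 t (\<lambda>_. undefined)) = space (PiM {0..<t} (\<lambda>_. stage_space))"
    using IT.space_C[of "\<lambda>_. undefined" 0 t] by simp
  then show ?thesis
    unfolding strategic_measure_def
    by (subst IT.nn_integral_lim_component[OF f])
      (auto intro!: nn_integral_cong nn_integral_stage_law[OF \<pi> f])
qed

lemma prob_space_policy:
  assumes \<pi>: "\<pi> \<in> policies" and \<omega>: "\<omega> \<in> space (PiM {0..<t} (\<lambda>_. stage_space))"
  shows "prob_space (\<pi> t \<omega> x)"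
proof -
  have "(\<lambda>(\<omega>, x). \<pi> t \<omega> x)
      \<in> (PiM {0..<t} (\<lambda>_. stage_space) \<Otimes>\<^sub>M borel) \<rightarrow>\<^sub>M prob_algebra action_space"
    using \<pi> by (auto simp: policies_def)
  from measurable_space[OF this, of "(\<omega>, x)"] \<omega> show ?thesis
    by (auto simp: space_prob_algebra space_pair_measure)
qed

lemma space_IT_C:
  assumes \<pi>: "\<pi> \<in> policies"
  shows "space (Ionescu_Tulcea.C (stage_law \<pi> x0) (\<lambda>_. stage_space) 0 t (\<lambda>_. undefined)) =
    space (PiM {0..<t} (\<lambda>_. stage_space))"
proof -
  interpret IT: Ionescu_Tulcea "stage_law \<pi> x0" "\<lambda>_. stage_space"
    by (rule Ionescu_Tulcea_stage_law[OF \<pi>])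
  show ?thesis using IT.space_C[of "\<lambda>_. undefined" 0 t] by simp
qed

text \<open>The action kernel has total mass one, so the action integrates out.\<close>

lemma nn_integral_strategic_state:
  assumes \<pi>: "\<pi> \<in> policies" and g[measurable]: "g \<in> borel_measurable borel"
  shows "(\<integral>\<^sup>+\<omega>. g (fst (\<omega> t)) \<partial>strategic_measure \<pi> x0) =
    (\<integral>\<^sup>+\<omega>. (\<integral>\<^sup>+x. g x \<partial>state_law x0 t \<omega>)
      \<partial>Ionescu_Tulcea.C (stage_law \<pi> x0) (\<lambda>_. stage_space) 0 t (\<lambda>_. undefined))"
  by (subst nn_integral_strategic_component[OF \<pi>, where f="\<lambda>z. g (fst z)"])
    (auto intro!: nn_integral_cong simp: space_IT_C[OF \<pi>] prob_space.emeasure_space_1[OF prob_space_policy[OF \<pi>]])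

lemma nn_integral_strategic_state_0:
  assumes \<pi>: "\<pi> \<in> policies" and g: "g \<in> borel_measurable borel"
  shows "(\<integral>\<^sup>+\<omega>. g (fst (\<omega> 0)) \<partial>strategic_measure \<pi> x0) = g x0"
proof -
  interpret IT: Ionescu_Tulcea "stage_law \<pi> x0" "\<lambda>_. stage_space"
    by (rule Ionescu_Tulcea_stage_law[OF \<pi>])
  show ?thesis
    using g by (simp add: nn_integral_strategic_state[OF \<pi> g] state_law_def nn_integral_return
      emeasure_return PiM_empty)
qed

lemma snd_stage_space[measurable]: "snd \<in> borel_measurable stage_space"
proof -
  have "(\<lambda>a. a) \<in> borel_measurable action_space"
    by (rule measurable_restrict_space1) simp
  from measurable_compose[OF measurable_snd[of borel action_space] this] show ?thesis by simp
qed

text \<open>Transition rule of the state process: both sides equal the integral of one function of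
  stage \<open>t\<close> over the measure on \<open>Suc t\<close> stages.\<close>

lemma nn_integral_strategic_state_Suc:
  assumes \<pi>: "\<pi> \<in> policies" and g[measurable]: "g \<in> borel_measurable borel"
  shows "(\<integral>\<^sup>+\<omega>. g (fst (\<omega> (Suc t))) \<partial>strategic_measure \<pi> x0) =
    (\<integral>\<^sup>+\<omega>. (\<integral>\<^sup>+\<xi>. g (fst (\<omega> t) + snd (\<omega> t) - D 1 \<xi>) \<partial>M) \<partial>strategic_measure \<pi> x0)"
proof -
  interpret IT: Ionescu_Tulcea "stage_law \<pi> x0" "\<lambda>_. stage_space"
    by (rule Ionescu_Tulcea_stage_law[OF \<pi>])
  have [measurable]: "D 1 \<in> borel_measurable M" by (rule D_measurable) simp
  let ?f = "\<lambda>z. (\<integral>\<^sup>+\<xi>. g (fst z + snd z - D 1 \<xi>) \<partial>M)"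
  have f: "?f \<in> borel_measurable stage_space"
    by measurable
  have "(\<integral>\<^sup>+\<omega>. g (fst (\<omega> (Suc t))) \<partial>strategic_measure \<pi> x0) =
      (\<integral>\<^sup>+\<omega>. ?f (\<omega> t) \<partial>IT.C 0 (Suc t) (\<lambda>_. undefined))"
    by (simp only: nn_integral_strategic_state[OF \<pi> g] nn_integral_state_law_Suc[OF g])
  also have "\<dots> = (\<integral>\<^sup>+\<omega>. ?f (\<omega> t) \<partial>strategic_measure \<pi> x0)"
    unfolding strategic_measure_def
    by (simp only: IT.nn_integral_C_Suc[OF f] IT.nn_integral_lim_component[OF f])
  finally show ?thesis .
qed

text \<open>A deterministic stationary policy, encoded as a point-mass kernel.\<close>

definition markov_policy :: "(real \<Rightarrow> real) \<Rightarrow> nat \<Rightarrow> (nat \<Rightarrow> real \<times> real) \<Rightarrow> real \<Rightarrow> real measure" where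
  "markov_policy \<phi> t \<omega> x = return action_space (\<phi> x)"

lemma markov_policy_in_policies:
  assumes [measurable]: "\<phi> \<in> borel_measurable borel" and nonneg: "\<And>x. \<phi> x \<ge> 0"
  shows "markov_policy \<phi> \<in> policies"
proof -
  have [measurable]: "\<phi> \<in> borel \<rightarrow>\<^sub>M action_space"
    using nonneg by (intro measurable_restrict_space2) auto
  show ?thesis
    unfolding policies_def markov_policy_def by (auto simp: case_prod_beta) measurable
qed

lemma nn_integral_strategic_markov_policy:
  assumes \<phi>[measurable]: "\<phi> \<in> borel_measurable borel" and nonneg: "\<And>x. \<phi> x \<ge> 0"
    and f[measurable]: "f \<in> borel_measurable stage_space"
  shows "(\<integral>\<^sup>+\<omega>. f (\<omega> t) \<partial>strategic_measure (markov_policy \<phi>) x0) =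
    (\<integral>\<^sup>+\<omega>. f (fst (\<omega> t), \<phi> (fst (\<omega> t))) \<partial>strategic_measure (markov_policy \<phi>) x0)"
proof -
  note \<pi> = markov_policy_in_policies[OF \<phi> nonneg]
  have [measurable]: "\<phi> \<in> borel \<rightarrow>\<^sub>M action_space"
    using nonneg by (intro measurable_restrict_space2) auto
  have g: "(\<lambda>x. f (x, \<phi> x)) \<in> borel_measurable borel" by measurable
  have *: "(\<integral>\<^sup>+a. f (x, a) \<partial>markov_policy \<phi> t \<omega> x) = f (x, \<phi> x)" for \<omega> x
    unfolding markov_policy_def
    by (rule nn_integral_return) (auto simp: space_restrict_space nonneg)
  show ?thesis
    by (simp add: nn_integral_strategic_component[OF \<pi> f] nn_integral_strategic_state[OF \<pi> g] *)
qed

end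

section \<open>Verification of the value function\<close>

context inventory_model
begin

definition mean_cost :: "real \<Rightarrow> real" where
  "mean_cost x = expectation (\<lambda>\<omega>. h (x - D 1 \<omega>))"

lemma cost_eq: "cost x a = (if a > 0 then K else 0) + cbar * a + mean_cost (x + a)"
  by (simp add: cost_def mean_cost_def)

lemma continuous_mean_cost: "continuous_on UNIV mean_cost"
  using Eh_continuous by (simp add: mean_cost_def[abs_def])

lemma mean_cost_nonneg: "mean_cost x \<ge> 0"
  using Eh_nonneg by (simp add: mean_cost_def)

lemma mean_cost_measurable[measurable]: "mean_cost \<in> borel_measurable borel"
  by (rule borel_measurable_continuous_onI[OF continuous_mean_cost])

lemma cost_nonneg: "a \<ge> 0 \<Longrightarrow> cost x a \<ge> 0"
  using K_pos cbar_pos mean_cost_nonneg[of "x + a"] by (simp add: cost_eq)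

lemma cost_measurable[measurable]: "(\<lambda>z. cost (fst z) (snd z)) \<in> borel_measurable stage_space"
  unfolding cost_eq by measurable

text \<open>All terms are nonnegative, so sum and integral may be exchanged.\<close>

lemma disc_cost_eq_suminf:
  assumes \<pi>: "\<pi> \<in> policies" and \<alpha>: "0 \<le> \<alpha>"
  shows "disc_cost \<alpha> \<pi> x =
    (\<Sum>t. ennreal \<alpha> ^ t * (\<integral>\<^sup>+\<omega>. ennreal (cost (fst (\<omega> t)) (snd (\<omega> t))) \<partial>strategic_measure \<pi> x))"
proof -
  have comp: "(\<lambda>\<omega>. \<omega> t) \<in> strategic_measure \<pi> x \<rightarrow>\<^sub>M stage_space" for t
    unfolding measurable_cong_sets[OF sets_strategic_measure[OF \<pi>] refl]
    by (rule measurable_component_singleton) simp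
  have [measurable]: "(\<lambda>\<omega>. cost (fst (\<omega> t)) (snd (\<omega> t))) \<in> borel_measurable (strategic_measure \<pi> x)" for t
    by (rule measurable_compose[OF comp cost_measurable])
  have "disc_cost \<alpha> \<pi> x = (\<Sum>t. \<integral>\<^sup>+\<omega>. ennreal (\<alpha> ^ t * cost (fst (\<omega> t)) (snd (\<omega> t))) \<partial>strategic_measure \<pi> x)"
    unfolding disc_cost_def by (rule nn_integral_suminf) measurable
  also have "\<dots> = (\<Sum>t. ennreal \<alpha> ^ t * (\<integral>\<^sup>+\<omega>. ennreal (cost (fst (\<omega> t)) (snd (\<omega> t))) \<partial>strategic_measure \<pi> x))"
    by (simp add: ennreal_mult' \<alpha> nn_integral_cmult ennreal_power)
  finally show ?thesis .
qed

text \<open>For policies of finite cost the growth bound makes the terminal term \<open>\<alpha>\<^sup>n E W(x\<^sub>n)\<close> vanish.\<close>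
lemma le_disc_cost:
  assumes \<pi>: "\<pi> \<in> policies" and \<alpha>: "0 \<le> \<alpha>" "\<alpha> < 1"
    and W[measurable]: "W \<in> borel_measurable borel"
    and c: "0 \<le> c1" "0 \<le> c2"
    and bellman: "\<And>x a. a \<ge> 0 \<Longrightarrow>
      ennreal (W x) \<le> ennreal (cost x a) + ennreal \<alpha> * (\<integral>\<^sup>+\<xi>. ennreal (W (x + a - D 1 \<xi>)) \<partial>M)"
    and growth: "\<And>x a. a \<ge> 0 \<Longrightarrow> W x \<le> c1 + c2 * cost x a"
  shows "ennreal (W x) \<le> disc_cost \<alpha> \<pi> x"
proof -
  let ?S = "strategic_measure \<pi> x"
  have prob: "emeasure ?S (space ?S) = 1"
    using nn_integral_strategic_state_0[OF \<pi>, of "\<lambda>_. 1" x] by simp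
  have [measurable]: "D 1 \<in> borel_measurable M" by (rule D_measurable) simp
  have comp[measurable]: "(\<lambda>\<omega>. \<omega> t) \<in> ?S \<rightarrow>\<^sub>M stage_space" for t
    unfolding measurable_cong_sets[OF sets_strategic_measure[OF \<pi>] refl]
    by (rule measurable_component_singleton) simp
  have cm[measurable]: "(\<lambda>\<omega>. cost (fst (\<omega> t)) (snd (\<omega> t))) \<in> borel_measurable ?S" for t
    by (rule measurable_compose[OF comp cost_measurable])
  have fm[measurable]: "(\<lambda>\<omega>. fst (\<omega> t)) \<in> borel_measurable ?S" for t
    by (rule measurable_compose[OF comp measurable_fst])
  have sm[measurable]: "(\<lambda>\<omega>. snd (\<omega> t)) \<in> borel_measurable ?S" for t
    by (rule measurable_compose[OF comp snd_stage_space])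
  have snd_nonneg: "snd (\<omega> t) \<ge> 0" if "\<omega> \<in> space ?S" for \<omega> t
    using measurable_space[OF comp that, of t] by (auto simp: space_pair_measure space_restrict_space)
  define A where "A t = (\<integral>\<^sup>+\<omega>. ennreal (cost (fst (\<omega> t)) (snd (\<omega> t))) \<partial>?S)" for t
  define B where "B t = (\<integral>\<^sup>+\<omega>. ennreal (W (fst (\<omega> t))) \<partial>?S)" for t
  define sm where "sm n = (\<Sum>s<n. ennreal \<alpha> ^ s * A s)" for n
  have B0: "B 0 = ennreal (W x)"
    unfolding B_def by (rule nn_integral_strategic_state_0[OF \<pi>]) measurable
  have step: "B t \<le> A t + ennreal \<alpha> * B (Suc t)" for t
  proof -
    have "B t \<le> (\<integral>\<^sup>+\<omega>. ennreal (cost (fst (\<omega> t)) (snd (\<omega> t)))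
        + ennreal \<alpha> * (\<integral>\<^sup>+\<xi>. ennreal (W (fst (\<omega> t) + snd (\<omega> t) - D 1 \<xi>)) \<partial>M) \<partial>?S)"
      unfolding B_def by (intro nn_integral_mono bellman snd_nonneg)
    also have "\<dots> = A t + (\<integral>\<^sup>+\<omega>. ennreal \<alpha> * (\<integral>\<^sup>+\<xi>. ennreal (W (fst (\<omega> t) + snd (\<omega> t) - D 1 \<xi>)) \<partial>M) \<partial>?S)"
      unfolding A_def by (rule nn_integral_add) measurable
    also have "(\<integral>\<^sup>+\<omega>. ennreal \<alpha> * (\<integral>\<^sup>+\<xi>. ennreal (W (fst (\<omega> t) + snd (\<omega> t) - D 1 \<xi>)) \<partial>M) \<partial>?S)
      = ennreal \<alpha> * (\<integral>\<^sup>+\<omega>. (\<integral>\<^sup>+\<xi>. ennreal (W (fst (\<omega> t) + snd (\<omega> t) - D 1 \<xi>)) \<partial>M) \<partial>?S)"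
      by (rule nn_integral_cmult) measurable
    also have "(\<integral>\<^sup>+\<omega>. (\<integral>\<^sup>+\<xi>. ennreal (W (fst (\<omega> t) + snd (\<omega> t) - D 1 \<xi>)) \<partial>M) \<partial>?S) = B (Suc t)"
      unfolding B_def by (rule nn_integral_strategic_state_Suc[OF \<pi>, symmetric]) measurable
    finally show ?thesis .
  qed
  \<comment> \<open>Unrolling the one-step inequality leaves a terminal term, which has to vanish in
    the limit.\<close>
  have iter: "B 0 \<le> sm n + ennreal \<alpha> ^ n * B n" for n
  proof (induction n)
    case (Suc n)
    have "B 0 \<le> sm n + ennreal \<alpha> ^ n * (A n + ennreal \<alpha> * B (Suc n))"
      by (rule order_trans[OF Suc.IH]) (intro add_left_mono mult_left_mono step zero_le)
    also have "\<dots> = sm (Suc n) + ennreal \<alpha> ^ Suc n * B (Suc n)"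
      by (simp add: sm_def algebra_simps)
    finally show ?case .
  qed (simp add: sm_def)
  have grow: "B n \<le> ennreal c1 + ennreal c2 * A n" for n
  proof -
    have "B n \<le> (\<integral>\<^sup>+\<omega>. ennreal c1 + ennreal c2 * ennreal (cost (fst (\<omega> n)) (snd (\<omega> n))) \<partial>?S)"
      unfolding B_def
    proof (rule nn_integral_mono)
      fix \<omega> assume "\<omega> \<in> space ?S"
      note nn = snd_nonneg[OF this, of n]
      show "ennreal (W (fst (\<omega> n))) \<le> ennreal c1 + ennreal c2 * ennreal (cost (fst (\<omega> n)) (snd (\<omega> n)))"
        using ennreal_leI[OF growth[OF nn, of "fst (\<omega> n)"]] c cost_nonneg[OF nn, of "fst (\<omega> n)"]
        by (simp add: ennreal_plus[symmetric] ennreal_mult[symmetric] del: ennreal_plus)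
    qed
    also have "\<dots> = ennreal c1 + ennreal c2 * A n"
      unfolding A_def by (subst nn_integral_add) (auto simp: nn_integral_cmult prob)
    finally show ?thesis .
  qed
  have cost_sm: "disc_cost \<alpha> \<pi> x = (\<Sum>t. ennreal \<alpha> ^ t * A t)"
    unfolding A_def by (rule disc_cost_eq_suminf[OF \<pi> \<alpha>(1)])
  show ?thesis
  proof (cases "disc_cost \<alpha> \<pi> x = \<top>")
    case False
    have lim: "sm \<longlonglongrightarrow> disc_cost \<alpha> \<pi> x"
      unfolding sm_def cost_sm by (rule summable_LIMSEQ) simp
    \<comment> \<open>The terms of a series with finite sum tend to zero; by \<open>grow\<close>
      this removes the terminal term.\<close>
    have "(\<lambda>n. sm (Suc n) - sm n) \<longlonglongrightarrow> disc_cost \<alpha> \<pi> x - disc_cost \<alpha> \<pi> x"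
      by (rule tendsto_diff_ennreal) (use lim LIMSEQ_Suc[OF lim] False in auto)
    moreover have fin: "sm n \<noteq> \<top>" for n
    proof -
      have "sm n \<le> disc_cost \<alpha> \<pi> x"
        unfolding sm_def cost_sm by (rule sum_le_suminf) auto
      with False show ?thesis by (auto simp: top_unique)
    qed
    moreover have "sm (Suc n) - sm n = ennreal \<alpha> ^ n * A n" for n
      using fin[of n] by (simp add: sm_def)
    ultimately have A0: "(\<lambda>n. ennreal \<alpha> ^ n * A n) \<longlonglongrightarrow> 0"
      using False by simp
    have p0: "(\<lambda>n. ennreal \<alpha> ^ n) \<longlonglongrightarrow> 0"
      using tendsto_ennrealI[OF LIMSEQ_realpow_zero[OF \<alpha>]] \<alpha> by (simp add: ennreal_power)
    have "(\<lambda>n. sm n + (ennreal c1 * ennreal \<alpha> ^ n + ennreal c2 * (ennreal \<alpha> ^ n * A n)))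
        \<longlonglongrightarrow> disc_cost \<alpha> \<pi> x + (ennreal c1 * 0 + ennreal c2 * 0)"
      by (intro tendsto_add ennreal_tendsto_cmult lim p0 A0) auto
    moreover have "B 0 \<le> sm n + (ennreal c1 * ennreal \<alpha> ^ n + ennreal c2 * (ennreal \<alpha> ^ n * A n))" for n
    proof -
      have "B 0 \<le> sm n + ennreal \<alpha> ^ n * (ennreal c1 + ennreal c2 * A n)"
        by (rule order_trans[OF iter[of n]]) (intro add_left_mono mult_left_mono grow zero_le)
      then show ?thesis by (simp add: algebra_simps)
    qed
    ultimately have "B 0 \<le> disc_cost \<alpha> \<pi> x + (ennreal c1 * 0 + ennreal c2 * 0)"
      by (intro LIMSEQ_le_const) auto
    then show ?thesis by (simp add: B0)
  qed simp
qed

text \<open>Unrolling the supersolution inequality bounds each partial cost plus a nonnegative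
  terminal term by \<open>W x\<close>; the terminal term is then dropped.\<close>

lemma disc_cost_markov_policy_le:
  assumes \<phi>[measurable]: "\<phi> \<in> borel_measurable borel" and nonneg: "\<And>x. \<phi> x \<ge> 0"
    and \<alpha>: "0 \<le> \<alpha>"
    and W[measurable]: "W \<in> borel_measurable borel"
    and bellman: "\<And>x. ennreal (cost x (\<phi> x)) + ennreal \<alpha> * (\<integral>\<^sup>+\<xi>. ennreal (W (x + \<phi> x - D 1 \<xi>)) \<partial>M)
      \<le> ennreal (W x)"
  shows "disc_cost \<alpha> (markov_policy \<phi>) x \<le> ennreal (W x)"
proof -
  let ?S = "strategic_measure (markov_policy \<phi>) x"
  note \<pi> = markov_policy_in_policies[OF \<phi> nonneg]
  have [measurable]: "D 1 \<in> borel_measurable M" by (rule D_measurable) simp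
  have comp[measurable]: "(\<lambda>\<omega>. \<omega> t) \<in> ?S \<rightarrow>\<^sub>M stage_space" for t
    unfolding measurable_cong_sets[OF sets_strategic_measure[OF \<pi>] refl]
    by (rule measurable_component_singleton) simp
  have fm[measurable]: "(\<lambda>\<omega>. fst (\<omega> t)) \<in> borel_measurable ?S" for t
    by (rule measurable_compose[OF comp measurable_fst])
  define A where "A t = (\<integral>\<^sup>+\<omega>. ennreal (cost (fst (\<omega> t)) (snd (\<omega> t))) \<partial>?S)" for t
  define B where "B t = (\<integral>\<^sup>+\<omega>. ennreal (W (fst (\<omega> t))) \<partial>?S)" for t
  have B0: "B 0 = ennreal (W x)"
    unfolding B_def by (rule nn_integral_strategic_state_0[OF \<pi>]) measurable
  have A: "A t = (\<integral>\<^sup>+\<omega>. ennreal (cost (fst (\<omega> t)) (\<phi> (fst (\<omega> t)))) \<partial>?S)" for t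
    unfolding A_def
    by (subst nn_integral_strategic_markov_policy[OF \<phi> nonneg, where f="\<lambda>z. ennreal (cost (fst z) (snd z))"]) auto
  have B: "B (Suc t) = (\<integral>\<^sup>+\<omega>. (\<integral>\<^sup>+\<xi>. ennreal (W (fst (\<omega> t) + \<phi> (fst (\<omega> t)) - D 1 \<xi>)) \<partial>M) \<partial>?S)" for t
  proof -
    have f2: "(\<lambda>z. \<integral>\<^sup>+\<xi>. ennreal (W (fst z + snd z - D 1 \<xi>)) \<partial>M) \<in> borel_measurable stage_space"
      by measurable
    have "B (Suc t) = (\<integral>\<^sup>+\<omega>. (\<integral>\<^sup>+\<xi>. ennreal (W (fst (\<omega> t) + snd (\<omega> t) - D 1 \<xi>)) \<partial>M) \<partial>?S)"
      unfolding B_def by (rule nn_integral_strategic_state_Suc[OF \<pi>]) measurable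
    also have "\<dots> = (\<integral>\<^sup>+\<omega>. (\<integral>\<^sup>+\<xi>. ennreal (W (fst (\<omega> t) + \<phi> (fst (\<omega> t)) - D 1 \<xi>)) \<partial>M) \<partial>?S)"
      using nn_integral_strategic_markov_policy[OF \<phi> nonneg f2] by simp
    finally show ?thesis .
  qed
  have [measurable]: "(\<lambda>\<omega>. cost (fst (\<omega> t)) (\<phi> (fst (\<omega> t)))) \<in> borel_measurable ?S" for t
    unfolding cost_eq by measurable
  have step: "A t + ennreal \<alpha> * B (Suc t) \<le> B t" for t
  proof -
    have "A t + ennreal \<alpha> * B (Suc t) = A t + (\<integral>\<^sup>+\<omega>. ennreal \<alpha> *
        (\<integral>\<^sup>+\<xi>. ennreal (W (fst (\<omega> t) + \<phi> (fst (\<omega> t)) - D 1 \<xi>)) \<partial>M) \<partial>?S)"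
      unfolding B by (subst nn_integral_cmult) measurable
    also have "\<dots> = (\<integral>\<^sup>+\<omega>. ennreal (cost (fst (\<omega> t)) (\<phi> (fst (\<omega> t))))
        + ennreal \<alpha> * (\<integral>\<^sup>+\<xi>. ennreal (W (fst (\<omega> t) + \<phi> (fst (\<omega> t)) - D 1 \<xi>)) \<partial>M) \<partial>?S)"
      unfolding A by (rule nn_integral_add[symmetric]) measurable
    also have "\<dots> \<le> B t"
      unfolding B_def by (intro nn_integral_mono bellman)
    finally show ?thesis .
  qed
  have iter: "(\<Sum>s<n. ennreal \<alpha> ^ s * A s) + ennreal \<alpha> ^ n * B n \<le> B 0" for n
  proof (induction n)
    case (Suc n)
    have "(\<Sum>s<Suc n. ennreal \<alpha> ^ s * A s) + ennreal \<alpha> ^ Suc n * B (Suc n)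
        = (\<Sum>s<n. ennreal \<alpha> ^ s * A s) + ennreal \<alpha> ^ n * (A n + ennreal \<alpha> * B (Suc n))"
      by (simp add: algebra_simps)
    also have "\<dots> \<le> (\<Sum>s<n. ennreal \<alpha> ^ s * A s) + ennreal \<alpha> ^ n * B n"
      using step[of n] by (intro add_left_mono mult_left_mono) auto
    finally show ?case using Suc.IH by (rule order_trans)
  qed simp
  have "disc_cost \<alpha> (markov_policy \<phi>) x = (\<Sum>t. ennreal \<alpha> ^ t * A t)"
    unfolding A_def by (rule disc_cost_eq_suminf[OF \<pi> \<alpha>])
  also have "\<dots> \<le> B 0"
    unfolding suminf_eq_SUP
  proof (rule SUP_least)
    fix n
    have "(\<Sum>s<n. ennreal \<alpha> ^ s * A s) \<le> (\<Sum>s<n. ennreal \<alpha> ^ s * A s) + ennreal \<alpha> ^ n * B n" by simp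
    then show "(\<Sum>s<n. ennreal \<alpha> ^ s * A s) \<le> B 0" using iter[of n] by (rule order_trans)
  qed
  finally show ?thesis by (simp add: B0)
qed

end

section \<open>The renewal operator\<close>

text \<open>Vanishing on the far left keeps the weight \<open>exp (- x)\<close> harmless near minus
  infinity.\<close>

definition left_null :: "real \<Rightarrow> (real \<Rightarrow> real) \<Rightarrow> bool" where
  "left_null a f \<longleftrightarrow> continuous_on UNIV f \<and> (\<forall>x\<le>a. f x = 0)"

text \<open>Demand is nonnegative, so \<open>f (x - D 1 \<omega>)\<close> samples \<open>f\<close>
  only up to \<open>x\<close>; bounds on left half-lines therefore give integrability.\<close>

definition left_bounded :: "(real \<Rightarrow> real) \<Rightarrow> bool" where
  "left_bounded f \<longleftrightarrow> f \<in> borel_measurable borel \<and> (\<forall>B. \<exists>c. \<forall>x\<le>B. \<bar>f x\<bar> \<le> c)"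

lemma left_null_mono: "left_null a f \<Longrightarrow> a' \<le> a \<Longrightarrow> left_null a' f"
  by (auto simp: left_null_def)

lemma left_boundedD:
  assumes "left_bounded f"
  obtains c where "\<And>x. x \<le> B \<Longrightarrow> \<bar>f x\<bar> \<le> c"
  using assms by (auto simp: left_bounded_def)

lemma left_bounded_measurable[measurable_dest]: "left_bounded f \<Longrightarrow> f \<in> borel_measurable borel"
  by (simp add: left_bounded_def)

lemma left_null_left_bounded:
  assumes "left_null a f"
  shows "left_bounded f"
  unfolding left_bounded_def
proof (intro conjI allI)
  have f: "continuous_on UNIV f" "\<And>x. x \<le> a \<Longrightarrow> f x = 0" using assms by (auto simp: left_null_def)
  show "f \<in> borel_measurable borel" by (rule borel_measurable_continuous_onI[OF f(1)])
  fix B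
  have "compact (f ` {a..B})"
    by (rule compact_continuous_image[OF continuous_on_subset[OF f(1)]]) auto
  then obtain c where c: "\<And>x. x \<in> {a..B} \<Longrightarrow> \<bar>f x\<bar> \<le> c"
    using compact_imp_bounded by (fastforce simp: bounded_iff)
  have "\<bar>f x\<bar> \<le> max c 0" if "x \<le> B" for x
    using c[of x] f(2)[of x] that by (cases "x \<le> a") auto
  then show "\<exists>c. \<forall>x\<le>B. \<bar>f x\<bar> \<le> c" by blast
qed

lemma left_bounded_add: "left_bounded f \<Longrightarrow> left_bounded g \<Longrightarrow> left_bounded (\<lambda>x. f x + g x)"
  unfolding left_bounded_def
proof (intro conjI allI)
  fix B
  assume "f \<in> borel_measurable borel \<and> (\<forall>B. \<exists>c. \<forall>x\<le>B. \<bar>f x\<bar> \<le> c)"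
    "g \<in> borel_measurable borel \<and> (\<forall>B. \<exists>c. \<forall>x\<le>B. \<bar>g x\<bar> \<le> c)"
  then obtain c d where cd: "\<And>x. x \<le> B \<Longrightarrow> \<bar>f x\<bar> \<le> c" "\<And>x. x \<le> B \<Longrightarrow> \<bar>g x\<bar> \<le> d" by meson
  have "\<bar>f x + g x\<bar> \<le> c + d" if "x \<le> B" for x
    using cd[OF that] by linarith
  then show "\<exists>c. \<forall>x\<le>B. \<bar>f x + g x\<bar> \<le> c" by blast
qed auto

lemma left_bounded_cmult: "left_bounded f \<Longrightarrow> left_bounded (\<lambda>x. k * f x)"
  unfolding left_bounded_def
proof (intro conjI allI)
  fix B
  assume "f \<in> borel_measurable borel \<and> (\<forall>B. \<exists>c. \<forall>x\<le>B. \<bar>f x\<bar> \<le> c)"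
  then obtain c where c: "\<And>x. x \<le> B \<Longrightarrow> \<bar>f x\<bar> \<le> c" by meson
  have "\<bar>k * f x\<bar> \<le> \<bar>k\<bar> * c" if "x \<le> B" for x
    using c[OF that] by (simp add: abs_mult mult_left_mono)
  then show "\<exists>c. \<forall>x\<le>B. \<bar>k * f x\<bar> \<le> c" by blast
qed auto

lemma left_bounded_const: "left_bounded (\<lambda>x. k)"
  by (auto simp: left_bounded_def)

lemma left_bounded_diff: "left_bounded f \<Longrightarrow> left_bounded g \<Longrightarrow> left_bounded (\<lambda>x. f x - g x)"
  using left_bounded_add[of f "\<lambda>x. -1 * g x"] left_bounded_cmult[of g "-1"] by simp

lemma left_bounded_shift: "left_bounded f \<Longrightarrow> left_bounded (\<lambda>x. f (x + d))"
  unfolding left_bounded_def by (auto, metis add_le_cancel_right)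

lemma left_bounded_abs: "left_bounded f \<Longrightarrow> left_bounded (\<lambda>x. \<bar>f x\<bar>)"
  unfolding left_bounded_def by auto

lemma left_bounded_max0:
  assumes "left_bounded f"
  shows "left_bounded (\<lambda>x. max (f x) 0)"
  unfolding left_bounded_def
proof (intro conjI allI)
  show "(\<lambda>x. max (f x) 0) \<in> borel_measurable borel"
    using left_bounded_measurable[OF assms] by measurable
  fix B
  obtain c where c: "\<And>x. x \<le> B \<Longrightarrow> \<bar>f x\<bar> \<le> c" using left_boundedD[OF assms] by metis
  show "\<exists>c. \<forall>x\<le>B. \<bar>max (f x) 0\<bar> \<le> c"
    using c by (intro exI[of _ c]) (force simp: max_def)
qed

context inventory_model
begin

section \<open>Averaging over one demand as a contraction\<close>

lemma D1_measurable[measurable]: "D (Suc 0) \<in> borel_measurable M"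
  using D_measurable[of 1] by simp

lemma D1_nonneg: "\<omega> \<in> space M \<Longrightarrow> D (Suc 0) \<omega> \<ge> 0"
  using D_nonneg[of 1] by simp

definition demand_mean :: "(real \<Rightarrow> real) \<Rightarrow> real \<Rightarrow> real" where
  "demand_mean f x = expectation (\<lambda>\<omega>. f (x - D 1 \<omega>))"

text \<open>The Laplace transform of the demand at 1.\<close>

definition \<theta> :: real where
  "\<theta> = expectation (\<lambda>\<omega>. exp (- D 1 \<omega>))"

lemma integrable_exp_D: "integrable M (\<lambda>\<omega>. exp (- D 1 \<omega>))"
  by (rule integrable_const_bound[where B=1]) (auto intro!: AE_I2 D1_nonneg)

lemma \<theta>_nonneg: "0 \<le> \<theta>"
  unfolding \<theta>_def by (rule integral_nonneg_AE) simp

text \<open>Otherwise the nonnegative variable \<open>1 - exp (- D 1 \<omega>)\<close> has mean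
  zero, so demand vanishes almost surely, against \<open>D_nontrivial\<close>.\<close>

lemma \<theta>_less_1: "\<theta> < 1"
proof (rule ccontr)
  assume "\<not> \<theta> < 1"
  have i: "integrable M (\<lambda>\<omega>. 1 - exp (- D 1 \<omega>))"
    using integrable_exp_D by simp
  have "expectation (\<lambda>\<omega>. 1 - exp (- D 1 \<omega>)) = 1 - \<theta>"
    unfolding \<theta>_def using integrable_exp_D by (simp add: prob_space)
  moreover have nn: "AE \<omega> in M. 0 \<le> 1 - exp (- D 1 \<omega>)"
    by (auto intro!: AE_I2 D1_nonneg)
  ultimately have "expectation (\<lambda>\<omega>. 1 - exp (- D 1 \<omega>)) = 0"
    using integral_nonneg_AE[OF nn] \<open>\<not> \<theta> < 1\<close> by linarith
  then have "AE \<omega> in M. 1 - exp (- D 1 \<omega>) = 0"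
    using integral_nonneg_eq_0_iff_AE[OF i nn] by simp
  then have "AE \<omega> in M. \<not> D 1 \<omega> > 0" by eventually_elim simp
  then have "prob {\<omega> \<in> space M. D 1 \<omega> > 0} = 0"
    by (subst prob_eq_0) (auto simp: AE_iff_measurable)
  with D_nontrivial show False by simp
qed

lemma integrable_demand_shift:
  assumes "left_bounded f"
  shows "integrable M (\<lambda>\<omega>. f (x - D 1 \<omega>))"
proof -
  obtain c where c: "\<And>y. y \<le> x \<Longrightarrow> \<bar>f y\<bar> \<le> c" using left_boundedD[OF assms] by metis
  have [measurable]: "f \<in> borel_measurable borel" using assms by (rule left_bounded_measurable)
  show ?thesis
    by (rule integrable_const_bound[where B=c]) (auto intro!: AE_I2 c D1_nonneg)
qed

text \<open>The exponential is an eigenfunction with eigenvalue \<open>\<theta>\<close>; this is the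
  source of the contraction.\<close>

lemma demand_mean_exp: "demand_mean (\<lambda>y. k * exp y) x = k * \<theta> * exp x"
proof -
  have "demand_mean (\<lambda>y. k * exp y) x = expectation (\<lambda>\<omega>. k * exp x * exp (- D 1 \<omega>))"
    unfolding demand_mean_def by (intro Bochner_Integration.integral_cong) (auto simp: exp_diff exp_minus field_simps)
  then show ?thesis by (simp add: \<theta>_def)
qed

lemma left_bounded_exp: "left_bounded (\<lambda>y. k * exp y)"
proof (rule left_bounded_cmult)
  show "left_bounded (exp :: real \<Rightarrow> real)"
    unfolding left_bounded_def by (auto intro!: exI[of _ "exp _"])
qed

lemma demand_mean_mono:
  assumes "left_bounded f" "left_bounded g" "\<And>y. y \<le> x \<Longrightarrow> f y \<le> g y"
  shows "demand_mean f x \<le> demand_mean g x"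
  unfolding demand_mean_def
  by (intro integral_mono integrable_demand_shift assms) (auto intro!: D1_nonneg)

lemma demand_mean_const[simp]: "demand_mean (\<lambda>x. k) x = k"
  by (simp add: demand_mean_def prob_space)

lemma demand_mean_diff: "left_bounded f \<Longrightarrow> left_bounded g \<Longrightarrow>
    demand_mean (\<lambda>x. f x - g x) x = demand_mean f x - demand_mean g x"
  using integrable_demand_shift by (simp add: demand_mean_def)

lemma demand_mean_cmult: "demand_mean (\<lambda>x. k * f x) x = k * demand_mean f x"
  by (simp add: demand_mean_def)

lemma demand_mean_abs_le:
  assumes "left_bounded f"
  shows "\<bar>demand_mean f x\<bar> \<le> demand_mean (\<lambda>x. \<bar>f x\<bar>) x"
  unfolding demand_mean_def by (rule integral_abs_bound)

text \<open>Weighting by \<open>exp\<close> makes \<^const>\<open>demand_mean\<close> a contraction with factor \<^const>\<open>\<theta>\<close>, even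
  without discounting.\<close>
lemma renewal_bound:
  assumes e: "left_bounded e" and nonneg: "\<And>x. 0 \<le> e x"
    and null: "\<And>x. x \<le> a \<Longrightarrow> e x = 0" and \<eta>: "0 \<le> \<eta>"
    and sub: "\<And>x. a < x \<Longrightarrow> x \<le> B \<Longrightarrow> e x \<le> \<eta> + demand_mean e x"
    and x: "x \<le> B"
  shows "e x \<le> \<eta> * exp (B - a) / (1 - \<theta>)"
proof -
  obtain c where c: "\<And>x. x \<le> B \<Longrightarrow> \<bar>e x\<bar> \<le> c" using left_boundedD[OF e] by metis
  \<comment> \<open>A weighted supremum norm on \<open>{..B}\<close>, finite because
    \<open>e\<close> vanishes up to \<open>a\<close>.\<close>
  define F where "F = (SUP x\<in>{..B}. e x * exp (- x))"
  have bdd: "bdd_above ((\<lambda>x. e x * exp (- x)) ` {..B})"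
  proof (intro bdd_aboveI2)
    fix y assume "y \<in> {..B}"
    then have "\<bar>e y\<bar> \<le> c" by (intro c) auto
    then show "e y * exp (- y) \<le> c * exp (- a)"
      using null[of y] nonneg[of y] by (cases "y \<le> a") (auto intro!: mult_mono)
  qed
  have F: "e y * exp (- y) \<le> F" if "y \<le> B" for y
    unfolding F_def by (rule cSUP_upper[OF _ bdd]) (use that in auto)
  have F0: "0 \<le> F"
    using F[OF order_refl] nonneg[of B] by (meson exp_ge_zero mult_nonneg_nonneg order_trans)
  have Fe: "e y \<le> F * exp y" if "y \<le> B" for y
    using F[OF that] by (simp add: exp_minus field_simps)
  \<comment> \<open>Since \<open>\<theta> < 1\<close>, this inequality can be solved for
    \<open>F\<close>.\<close>
  have le: "F \<le> \<eta> * exp (- a) + \<theta> * F"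
    unfolding F_def
  proof (rule cSUP_least)
    fix y assume y: "y \<in> {..B}"
    show "e y * exp (- y) \<le> \<eta> * exp (- a) + \<theta> * (SUP x\<in>{..B}. e x * exp (- x))"
      unfolding F_def[symmetric]
    proof (cases "y \<le> a")
      case True
      then show "e y * exp (- y) \<le> \<eta> * exp (- a) + \<theta> * F"
        using \<eta> F0 \<theta>_nonneg by (simp add: null)
    next
      case False
      have "e y \<le> \<eta> + demand_mean e y" using sub[of y] y False by auto
      also have "demand_mean e y \<le> demand_mean (\<lambda>y. F * exp y) y"
        using y by (intro demand_mean_mono e left_bounded_exp Fe) auto
      finally have "e y \<le> \<eta> + F * \<theta> * exp y" by (simp add: demand_mean_exp)
      then have "e y * exp (- y) \<le> (\<eta> + F * \<theta> * exp y) * exp (- y)"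
        by (intro mult_right_mono) auto
      also have "\<dots> = \<eta> * exp (- y) + \<theta> * F"
        by (simp add: algebra_simps exp_minus)
      also have "\<eta> * exp (- y) \<le> \<eta> * exp (- a)"
        using False \<eta> by (intro mult_left_mono) auto
      finally show "e y * exp (- y) \<le> \<eta> * exp (- a) + \<theta> * F" by simp
    qed
  qed auto
  have "F * (1 - \<theta>) \<le> \<eta> * exp (- a)" using le by (simp add: algebra_simps)
  then have F1: "F \<le> \<eta> * exp (- a) / (1 - \<theta>)" using \<theta>_less_1 by (simp add: field_simps)
  have "e x \<le> F * exp x" by (rule Fe[OF x])
  also have "\<dots> \<le> (\<eta> * exp (- a) / (1 - \<theta>)) * exp B"
    using F0 F1 x by (intro mult_mono) auto
  also have "\<dots> = \<eta> * exp (B - a) / (1 - \<theta>)" by (simp add: exp_diff exp_minus field_simps)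
  finally show ?thesis .
qed

text \<open>From \<open>\<alpha> * C \<le> C\<close> the positive part of \<open>f - C\<close> is a
  subsolution that vanishes up to \<open>b\<close>, so \<open>renewal_bound\<close> with error zero
  applies.\<close>

lemma renewal_maximum_principle:
  assumes f: "left_bounded f" and C: "0 \<le> C" and \<alpha>: "0 \<le> \<alpha>" "\<alpha> \<le> 1"
    and left: "\<And>x. x \<le> b \<Longrightarrow> f x \<le> C"
    and sub: "\<And>x. b < x \<Longrightarrow> x \<le> B \<Longrightarrow> f x \<le> \<alpha> * demand_mean f x"
    and x: "x \<le> B"
  shows "f x \<le> C"
proof -
  let ?e = "\<lambda>x. max (f x - C) 0"
  have fC: "left_bounded (\<lambda>x. f x - C)" by (intro left_bounded_diff f left_bounded_const)
  have e: "left_bounded ?e" by (rule left_bounded_max0[OF fC])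
  have "?e x \<le> 0 * exp (B - b) / (1 - \<theta>)"
  proof (rule renewal_bound[OF e])
    fix y assume y: "b < y" "y \<le> B"
    have "0 \<le> demand_mean ?e y"
      using demand_mean_mono[OF left_bounded_const[of 0] e, of y] by simp
    moreover have "f y - C \<le> demand_mean ?e y"
    proof -
      have "f y - C \<le> \<alpha> * demand_mean f y - \<alpha> * C"
        using sub[OF y] mult_right_mono[OF \<alpha>(2) C] by simp
      also have "\<dots> = \<alpha> * demand_mean (\<lambda>x. f x - C) y"
        by (simp add: demand_mean_diff[OF f left_bounded_const] algebra_simps)
      also have "\<dots> \<le> \<alpha> * demand_mean ?e y"
        using \<alpha> by (intro mult_left_mono demand_mean_mono e fC) auto
      also have "\<dots> \<le> demand_mean ?e y"
        using \<alpha> \<open>0 \<le> demand_mean ?e y\<close> by (simp add: mult_left_le_one_le)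
      finally show ?thesis .
    qed
    ultimately show "?e y \<le> 0 + demand_mean ?e y" by simp
  qed (use left x in auto)
  then show ?thesis by simp
qed

text \<open>Nonnegative demand only looks to the left, which preserves vanishing; continuity is
  dominated convergence with a bound on a left half-line.\<close>

lemma left_null_demand_mean:
  assumes "left_null a f"
  shows "left_null a (demand_mean f)"
  unfolding left_null_def
proof (intro conjI allI impI)
  have f: "continuous_on UNIV f" "\<And>x. x \<le> a \<Longrightarrow> f x = 0" using assms by (auto simp: left_null_def)
  note lb = left_null_left_bounded[OF assms]
  have [measurable]: "f \<in> borel_measurable borel" by (rule left_bounded_measurable[OF lb])
  show "demand_mean f x = 0" if "x \<le> a" for x
  proof -
    have "demand_mean f x = expectation (\<lambda>\<omega>. 0)"
      unfolding demand_mean_def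
    proof (intro Bochner_Integration.integral_cong refl)
      fix \<omega> assume "\<omega> \<in> space M"
      then show "f (x - D 1 \<omega>) = 0" using D1_nonneg[of \<omega>] that by (intro f(2)) auto
    qed
    then show ?thesis by simp
  qed
  show "continuous_on UNIV (demand_mean f)"
    unfolding continuous_on_sequentially
  proof (safe, unfold comp_def)
    fix X :: "nat \<Rightarrow> real" and x assume X: "X \<longlonglongrightarrow> x"
    then obtain B where "\<And>n. \<bar>X n\<bar> \<le> B"
      using convergent_imp_Bseq[OF convergentI[OF X]] by (auto simp: Bseq_def)
    then have B: "X n \<le> B" for n by (meson abs_le_D1)
    obtain c where c: "\<And>x. x \<le> B \<Longrightarrow> \<bar>f x\<bar> \<le> c" using left_boundedD[OF lb] by metis
    show "(\<lambda>n. demand_mean f (X n)) \<longlonglongrightarrow> demand_mean f x"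
      unfolding demand_mean_def
    proof (rule integral_dominated_convergence[where w="\<lambda>_. c"])
      show "AE \<omega> in M. (\<lambda>n. f (X n - D 1 \<omega>)) \<longlonglongrightarrow> f (x - D 1 \<omega>)"
        using f(1) X by (intro AE_I2 continuous_on_tendsto_compose[OF f(1)] tendsto_intros) auto
      show "AE \<omega> in M. norm (f (X n - D 1 \<omega>)) \<le> c" for n
      proof (intro AE_I2)
        fix \<omega> assume "\<omega> \<in> space M"
        then show "norm (f (X n - D 1 \<omega>)) \<le> c"
          using D1_nonneg[of \<omega>] B[of n] c[of "X n - D 1 \<omega>"] by simp
      qed
    qed auto
  qed
qed

text \<open>The Neumann series for the inverse of the identity minus \<open>\<alpha>\<close> times
  \<open>demand_mean\<close>.\<close>

definition renewal :: "real \<Rightarrow> (real \<Rightarrow> real) \<Rightarrow> real \<Rightarrow> real" where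
  "renewal \<alpha> \<psi> x = (\<Sum>t. \<alpha> ^ t * (demand_mean ^^ t) \<psi> x)"

context
  fixes a \<alpha> :: real and \<psi> :: "real \<Rightarrow> real"
  assumes \<psi>: "left_null a \<psi>" and \<alpha>: "0 \<le> \<alpha>" "\<alpha> \<le> 1"
begin

lemma left_null_iterate: "left_null a ((demand_mean ^^ t) \<psi>)"
  by (induction t) (auto simp: \<psi> left_null_demand_mean)

text \<open>A source that vanishes up to \<open>a\<close> is dominated on \<open>{..B}\<close> by a
  multiple of \<open>exp\<close>, and each averaging multiplies that majorant by
  \<open>\<theta>\<close>. The decay thus persists at \<open>\<alpha> = 1\<close>.\<close>

lemma iterate_bound:
  obtains c where "0 \<le> c" "\<And>t x. x \<le> B \<Longrightarrow> \<bar>\<alpha> ^ t * (demand_mean ^^ t) \<psi> x\<bar> \<le> c * \<theta> ^ t"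
proof -
  obtain c where c: "\<And>x. x \<le> B \<Longrightarrow> \<bar>\<psi> x\<bar> \<le> c"
    using left_boundedD[OF left_null_left_bounded[OF \<psi>]] by metis
  have c0: "0 \<le> c" using c[OF order_refl] abs_ge_zero order_trans by blast
  have *: "\<bar>(demand_mean ^^ t) \<psi> x\<bar> \<le> (c * exp (- a) * \<theta> ^ t) * exp x" if "x \<le> B" for t x
    using that
  proof (induction t arbitrary: x)
    case 0
    show ?case
    proof (cases "x \<le> a")
      case True then show ?thesis using \<psi> c0 by (simp add: left_null_def)
    next
      case False
      then have "exp (a) \<le> exp x" by simp
      then have "c * exp a \<le> c * exp x" using c0 by (rule mult_left_mono)
      then have "c \<le> c * exp (- a) * exp x" by (simp add: exp_minus field_simps)
      with c[OF 0] show ?thesis by simp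
    qed
  next
    case (Suc t)
    note lb = left_null_left_bounded[OF left_null_iterate[of t]]
    have "\<bar>(demand_mean ^^ Suc t) \<psi> x\<bar> \<le> demand_mean (\<lambda>x. \<bar>(demand_mean ^^ t) \<psi> x\<bar>) x"
      using demand_mean_abs_le[OF lb] by simp
    also have "\<dots> \<le> demand_mean (\<lambda>x. (c * exp (- a) * \<theta> ^ t) * exp x) x"
      using Suc by (intro demand_mean_mono left_bounded_abs lb left_bounded_exp) auto
    also have "\<dots> = (c * exp (- a) * \<theta> ^ Suc t) * exp x"
      by (simp add: demand_mean_exp)
    finally show ?case .
  qed
  have "\<bar>\<alpha> ^ t * (demand_mean ^^ t) \<psi> x\<bar> \<le> (c * exp (- a) * exp B) * \<theta> ^ t" if "x \<le> B" for t x
  proof -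
    have "\<bar>\<alpha> ^ t * (demand_mean ^^ t) \<psi> x\<bar> \<le> 1 * \<bar>(demand_mean ^^ t) \<psi> x\<bar>"
      using \<alpha> power_le_one[OF \<alpha>, of t] unfolding abs_mult by (intro mult_right_mono) auto
    also have "\<dots> \<le> (c * exp (- a) * \<theta> ^ t) * exp x" using *[OF that] by simp
    also have "\<dots> \<le> (c * exp (- a) * \<theta> ^ t) * exp B"
      using c0 \<theta>_nonneg that by (intro mult_left_mono) auto
    finally show ?thesis by (simp add: mult_ac)
  qed
  then show ?thesis using that[of "c * exp (- a) * exp B"] c0 by simp
qed

lemma renewal_summable: "summable (\<lambda>t. \<bar>\<alpha> ^ t * (demand_mean ^^ t) \<psi> x\<bar>)"
proof -
  obtain c where c: "0 \<le> c" "\<And>t. \<bar>\<alpha> ^ t * (demand_mean ^^ t) \<psi> x\<bar> \<le> c * \<theta> ^ t"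
    using iterate_bound[of x] by (metis order_refl)
  show ?thesis
    by (rule summable_comparison_test'[where g="\<lambda>t. c * \<theta> ^ t" and N=0])
      (use c \<theta>_nonneg \<theta>_less_1 in \<open>auto intro!: summable_mult summable_geometric\<close>)
qed

text \<open>Continuity follows from the Weierstrass M-test on every left half-line.\<close>

lemma left_null_renewal: "left_null a (renewal \<alpha> \<psi>)"
  unfolding left_null_def
proof (intro conjI allI impI)
  show "renewal \<alpha> \<psi> x = 0" if "x \<le> a" for x
    using left_null_iterate that by (simp add: renewal_def left_null_def)
  have cont: "continuous_on {..B} (renewal \<alpha> \<psi>)" for B
  proof -
    obtain c where c: "0 \<le> c" "\<And>t x. x \<le> B \<Longrightarrow> \<bar>\<alpha> ^ t * (demand_mean ^^ t) \<psi> x\<bar> \<le> c * \<theta> ^ t"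
      using iterate_bound[of B] by metis
    have "uniform_limit {..B} (\<lambda>n x. \<Sum>t<n. \<alpha> ^ t * (demand_mean ^^ t) \<psi> x) (renewal \<alpha> \<psi>) sequentially"
      unfolding renewal_def[abs_def]
      by (rule Weierstrass_m_test[where M="\<lambda>t. c * \<theta> ^ t"])
        (use c \<theta>_nonneg \<theta>_less_1 in \<open>auto intro!: summable_mult summable_geometric\<close>)
    then show ?thesis
    proof (rule uniform_limit_theorem[rotated])
      have "continuous_on {..B} ((demand_mean ^^ t) \<psi>)" for t
        using left_null_iterate[of t] continuous_on_subset by (auto simp: left_null_def)
      then show "\<forall>\<^sub>F n in sequentially. continuous_on {..B} (\<lambda>x. \<Sum>t<n. \<alpha> ^ t * (demand_mean ^^ t) \<psi> x)"
        by (intro always_eventually allI continuous_intros)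
    qed simp
  qed
  show "continuous_on UNIV (renewal \<alpha> \<psi>)"
    unfolding continuous_on_eq_continuous_at[OF open_UNIV]
  proof
    fix x :: real
    have "continuous_on {..<x + 1} (renewal \<alpha> \<psi>)"
      by (rule continuous_on_subset[OF cont[of "x + 1"]]) auto
    then show "isCont (renewal \<alpha> \<psi>) x"
      by (simp add: continuous_on_eq_continuous_at)
  qed
qed

text \<open>Integrate the Neumann series term by term and shift the index.\<close>

lemma renewal_eq: "renewal \<alpha> \<psi> x = \<psi> x + \<alpha> * demand_mean (renewal \<alpha> \<psi>) x"
proof -
  let ?f = "\<lambda>t x. \<alpha> ^ t * (demand_mean ^^ t) \<psi> x"
  obtain c where c: "0 \<le> c" "\<And>t y. y \<le> x \<Longrightarrow> \<bar>?f t y\<bar> \<le> c * \<theta> ^ t"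
    using iterate_bound[of x] by metis
  have int: "integrable M (\<lambda>\<omega>. ?f t (x - D 1 \<omega>))" for t
    by (intro integrable_demand_shift left_bounded_cmult left_null_left_bounded[OF left_null_iterate])
  have geo: "summable (\<lambda>t. c * \<theta> ^ t)"
    using \<theta>_nonneg \<theta>_less_1 by (auto intro!: summable_mult summable_geometric)
  have "demand_mean (renewal \<alpha> \<psi>) x = (\<Sum>t. expectation (\<lambda>\<omega>. ?f t (x - D 1 \<omega>)))"
    unfolding demand_mean_def[of "renewal \<alpha> \<psi>"] renewal_def
  proof (rule integral_suminf[OF int])
    show "AE \<omega> in M. summable (\<lambda>t. norm (?f t (x - D 1 \<omega>)))"
      using renewal_summable by simp
    show "summable (\<lambda>t. expectation (\<lambda>\<omega>. norm (?f t (x - D 1 \<omega>))))"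
    proof (rule summable_comparison_test'[OF geo, where N=0])
      fix t
      have "expectation (\<lambda>\<omega>. norm (?f t (x - D 1 \<omega>))) \<le> expectation (\<lambda>\<omega>. c * \<theta> ^ t)"
        using int by (intro integral_mono) (auto intro!: c D1_nonneg)
      then show "norm (expectation (\<lambda>\<omega>. norm (?f t (x - D 1 \<omega>)))) \<le> c * \<theta> ^ t"
        by (simp add: prob_space integral_nonneg_AE)
    qed
  qed
  also have "\<dots> = (\<Sum>t. \<alpha> ^ t * (demand_mean ^^ Suc t) \<psi> x)"
    by (simp add: demand_mean_def)
  finally have "\<alpha> * demand_mean (renewal \<alpha> \<psi>) x = \<alpha> * (\<Sum>t. \<alpha> ^ t * (demand_mean ^^ Suc t) \<psi> x)"
    by simp
  also have "\<dots> = (\<Sum>t. ?f (Suc t) x)"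
  \<comment> \<open>Summability of the shifted series comes from dividing by
    \<open>\<alpha>\<close>, so zero is treated apart.\<close>
  proof (cases "\<alpha> = 0")
    case False
    have "summable (\<lambda>t. ?f (Suc t) x)"
      using summable_rabs_cancel[OF renewal_summable] by (subst summable_Suc_iff)
    then have "summable (\<lambda>t. inverse \<alpha> * ?f (Suc t) x)" by (rule summable_mult)
    then have "summable (\<lambda>t. \<alpha> ^ t * (demand_mean ^^ Suc t) \<psi> x)" using False by (simp add: field_simps)
    from suminf_mult[OF this, of \<alpha>] show ?thesis by (simp add: mult_ac)
  qed simp
  also have "\<dots> = renewal \<alpha> \<psi> x - \<psi> x"
    using suminf_split_head[OF summable_rabs_cancel[OF renewal_summable], of x] by (simp add: renewal_def)
  finally show ?thesis by simp
qed

lemma left_bounded_renewal: "left_bounded (renewal \<alpha> \<psi>)"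
  by (rule left_null_left_bounded[OF left_null_renewal])

end

text \<open>The difference of the two solutions obeys the maximum principle with
  \<open>C = 0\<close>.\<close>

lemma renewal_mono:
  assumes \<psi>: "left_null a \<psi>" "left_null a \<psi>'" and \<alpha>: "0 \<le> \<alpha>" "\<alpha> \<le> 1"
    and le: "\<And>y. y \<le> x \<Longrightarrow> \<psi> y \<le> \<psi>' y"
  shows "renewal \<alpha> \<psi> x \<le> renewal \<alpha> \<psi>' x"
proof -
  let ?f = "\<lambda>x. renewal \<alpha> \<psi> x - renewal \<alpha> \<psi>' x"
  note lb = left_bounded_renewal[OF \<psi>(1) \<alpha>] left_bounded_renewal[OF \<psi>(2) \<alpha>]
  have "?f x \<le> 0"
  proof (rule renewal_maximum_principle[where f="?f" and x=x and \<alpha>=\<alpha> and b=a and B=x])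
    show "left_bounded ?f" by (intro left_bounded_diff lb)
    show "?f y \<le> 0" if "y \<le> a" for y
      using left_null_renewal[OF \<psi>(1) \<alpha>] left_null_renewal[OF \<psi>(2) \<alpha>] that by (simp add: left_null_def)
    show "?f y \<le> \<alpha> * demand_mean ?f y" if "a < y" "y \<le> x" for y
      using renewal_eq[OF \<psi>(1) \<alpha>, of y] renewal_eq[OF \<psi>(2) \<alpha>, of y] le[of y] that
      by (simp add: demand_mean_diff[OF lb] algebra_simps)
  qed (use \<alpha> in auto)
  then show ?thesis by simp
qed

text \<open>The difference of the solutions solves a renewal equation whose source is the difference
  of the sources plus \<open>\<alpha> - \<alpha>'\<close> times an average of the second solution;
  \<open>c\<close> bounds that average.\<close>

lemma renewal_stable:
  assumes \<psi>: "left_null a \<psi>" "left_null a \<psi>'" and \<alpha>: "0 \<le> \<alpha>" "\<alpha> \<le> 1" and \<alpha>': "0 \<le> \<alpha>'" "\<alpha>' \<le> 1"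
    and \<eta>: "\<And>y. y \<le> B \<Longrightarrow> \<bar>\<psi> y - \<psi>' y\<bar> \<le> \<eta>"
    and c: "\<And>y. y \<le> B \<Longrightarrow> \<bar>renewal \<alpha>' \<psi>' y\<bar> \<le> c"
    and x: "x \<le> B"
  shows "\<bar>renewal \<alpha> \<psi> x - renewal \<alpha>' \<psi>' x\<bar> \<le> (\<eta> + \<bar>\<alpha> - \<alpha>'\<bar> * c) * exp (B - a) / (1 - \<theta>)"
proof -
  let ?f = "\<lambda>x. renewal \<alpha> \<psi> x - renewal \<alpha>' \<psi>' x"
  note lb = left_bounded_renewal[OF \<psi>(1) \<alpha>] left_bounded_renewal[OF \<psi>(2) \<alpha>']
  have lbf: "left_bounded ?f" by (intro left_bounded_diff lb)
  have "0 \<le> c" "0 \<le> \<eta>" using c[OF x] \<eta>[OF x] by (auto intro: order_trans[OF abs_ge_zero])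
  show ?thesis
  proof (rule renewal_bound[OF left_bounded_abs[OF lbf]])
    show "\<bar>?f y\<bar> = 0" if "y \<le> a" for y
      using left_null_renewal[OF \<psi>(1) \<alpha>] left_null_renewal[OF \<psi>(2) \<alpha>'] that by (simp add: left_null_def)
    show "\<bar>?f y\<bar> \<le> \<eta> + \<bar>\<alpha> - \<alpha>'\<bar> * c + demand_mean (\<lambda>y. \<bar>?f y\<bar>) y" if y: "y \<le> B" for y
    proof -
      have "?f y = (\<psi> y - \<psi>' y) + \<alpha> * demand_mean ?f y + (\<alpha> - \<alpha>') * demand_mean (renewal \<alpha>' \<psi>') y"
        using renewal_eq[OF \<psi>(1) \<alpha>, of y] renewal_eq[OF \<psi>(2) \<alpha>', of y]
        by (simp add: demand_mean_diff[OF lb] algebra_simps)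
      then have "\<bar>?f y\<bar> \<le> \<bar>\<psi> y - \<psi>' y\<bar> + \<bar>\<alpha> * demand_mean ?f y\<bar> + \<bar>(\<alpha> - \<alpha>') * demand_mean (renewal \<alpha>' \<psi>') y\<bar>"
        by linarith
      moreover have "\<bar>\<psi> y - \<psi>' y\<bar> \<le> \<eta>" by (rule \<eta>[OF y])
      moreover have "\<bar>\<alpha> * demand_mean ?f y\<bar> \<le> demand_mean (\<lambda>y. \<bar>?f y\<bar>) y"
      proof -
        have "\<bar>\<alpha> * demand_mean ?f y\<bar> \<le> \<bar>demand_mean ?f y\<bar>"
          using \<alpha> by (simp add: abs_mult mult_left_le_one_le)
        also have "\<dots> \<le> demand_mean (\<lambda>y. \<bar>?f y\<bar>) y" by (rule demand_mean_abs_le[OF lbf])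
        finally show ?thesis .
      qed
      moreover have "\<bar>(\<alpha> - \<alpha>') * demand_mean (renewal \<alpha>' \<psi>') y\<bar> \<le> \<bar>\<alpha> - \<alpha>'\<bar> * c"
      proof -
        have "\<bar>demand_mean (renewal \<alpha>' \<psi>') y\<bar> \<le> demand_mean (\<lambda>y. \<bar>renewal \<alpha>' \<psi>' y\<bar>) y"
          by (rule demand_mean_abs_le[OF lb(2)])
        also have "\<dots> \<le> demand_mean (\<lambda>_. c) y"
          using y by (intro demand_mean_mono left_bounded_abs lb left_bounded_const c) auto
        finally show ?thesis by (simp add: abs_mult mult_left_mono)
      qed
      ultimately show ?thesis by linarith
    qed
  qed (use x \<open>0 \<le> c\<close> \<open>0 \<le> \<eta>\<close> in auto)
qed

end

section \<open>Choice of the gain\<close>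

lemma quasiconvex_between:
  assumes "quasiconvex f" "x \<le> y" "y \<le> z"
  shows "f y \<le> max (f x) (f z)"
proof (cases "x = z")
  case False
  define t where "t = (z - y) / (z - x)"
  have t: "t \<in> {0..1}" using assms False by (simp add: t_def field_simps)
  have "t * (z - x) = z - y" using False by (simp add: t_def)
  then have "t * x + (1 - t) * z = y" by (simp add: algebra_simps)
  with assms(1) t show ?thesis unfolding quasiconvex_def by metis
qed (use assms in auto)

text \<open>The cost above level \<open>g\<close>, where no order is placed; the leftmost point with \<open>G \<le> g\<close> will be the
  reorder point.\<close>
definition excess :: "(real \<Rightarrow> real) \<Rightarrow> real \<Rightarrow> real \<Rightarrow> real" where
  "excess G g z = (if \<exists>y\<le>z. G y \<le> g then G z - g else 0)"

text \<open>Any \<open>p\<close> in the sublevel set can replace the existential test: up to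
  \<open>p\<close>, quasiconvexity makes the points past the reorder point exactly those with
  \<open>G z \<le> g\<close>. Excesses of different functions then become comparable through a
  common \<open>p\<close>.\<close>

lemma excess_cut:
  assumes G: "quasiconvex G" "G p \<le> g"
  shows "excess G g z = (if z > p then G z - g else min (G z - g) 0)"
proof (cases "z > p")
  case True
  then have "\<exists>y\<le>z. G y \<le> g" using G by (auto intro!: exI[of _ p])
  with True show ?thesis by (simp add: excess_def)
next
  case False
  show ?thesis
  proof (cases "\<exists>y\<le>z. G y \<le> g")
    case True
    then obtain y where "y \<le> z" "G y \<le> g" by blast
    with quasiconvex_between[OF G(1), of y z p] False G(2) have "G z \<le> g" by auto
    with True False show ?thesis by (simp add: excess_def)
  next
    case nex: False
    then have "G z > g" by force
    with nex False show ?thesis by (simp add: excess_def)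
  qed
qed

lemma left_null_excess:
  assumes G: "quasiconvex G" "continuous_on UNIV G" "G p \<le> g" and a: "a \<le> p" "g < G a"
  shows "left_null a (excess G g)"
  unfolding left_null_def
proof (intro conjI allI impI)
  \<comment> \<open>Clamping the argument at \<open>p\<close> glues the two branches into one
    visibly continuous formula.\<close>
  have eq: "excess G g = (\<lambda>z. G (max z p) - g + min (G (min z p) - g) 0 - (G p - g))"
  proof
    fix z
    show "excess G g z = G (max z p) - g + min (G (min z p) - g) 0 - (G p - g)"
      using G(3) by (cases "z > p") (auto simp: excess_cut[OF G(1,3)] max_def min_def)
  qed
  show "continuous_on UNIV (excess G g)"
    unfolding eq by (intro continuous_intros continuous_on_compose2[OF G(2)]) auto
  show "excess G g z = 0" if "z \<le> a" for z
  proof -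
    \<comment> \<open>A sublevel point left of \<open>a\<close>, together with \<open>p\<close>,
      would put \<open>a\<close> into the sublevel set.\<close>
    have "\<not> (\<exists>y\<le>z. G y \<le> g)"
    proof
      assume "\<exists>y\<le>z. G y \<le> g"
      then obtain y where "y \<le> z" "G y \<le> g" by blast
      with quasiconvex_between[OF G(1), of y a p] a that G(3) show False by auto
    qed
    then show ?thesis unfolding excess_def by (simp only: if_False)
  qed
qed

lemma excess_antimono:
  assumes G: "quasiconvex G" "G p \<le> g" and "g \<le> g'"
  shows "excess G g' z \<le> excess G g z"
  using excess_cut[OF G] excess_cut[OF G(1), of p g'] assms by auto

lemma excess_shift:
  assumes "g \<le> g'" "\<exists>y\<le>z. G y \<le> g"
  shows "excess G g' z = excess G g z - (g' - g)"
proof -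
  from assms(2) obtain y where "y \<le> z" "G y \<le> g" by blast
  then have "\<exists>y\<le>z. G y \<le> g'" using assms(1) by (intro exI[of _ y]) simp
  then show ?thesis unfolding excess_def by (simp only: assms(2) if_True)
qed

text \<open>With a common \<open>p\<close> both sides follow the same branch, and cutting at zero is
  1-Lipschitz.\<close>

lemma excess_diff_le:
  assumes "quasiconvex G" "G p \<le> g" "quasiconvex G'" "G' p \<le> g'"
  shows "\<bar>excess G g z - excess G' g' z\<bar> \<le> \<bar>G z - G' z\<bar> + \<bar>g - g'\<bar>"
  using excess_cut[OF assms(1,2)] excess_cut[OF assms(3,4)] by (auto simp: min_def)

context inventory_model
begin

section \<open>The functions \<open>Eh_disc \<alpha>\<close> and the level equation\<close>

abbreviation \<mu> :: real where "\<mu> \<equiv> expectation (D 1)"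

lemma \<mu>_nonneg: "0 \<le> \<mu>"
  by (rule integral_nonneg_AE) (auto intro!: AE_I2 D1_nonneg)

text \<open>Isolates the dependence on \<open>\<alpha>\<close>, which is affine.\<close>

lemma Eh_disc_eq: "Eh_disc \<alpha> x = mean_cost x + (1 - \<alpha>) * cbar * (x - \<mu>) + cbar * \<mu>"
proof -
  have "Eh_disc \<alpha> x = expectation (\<lambda>\<omega>. h (x - D 1 \<omega>) + ((1 - \<alpha>) * cbar * (x - D 1 \<omega>) + cbar * \<mu>))"
    unfolding Eh_disc_def h_disc_def by (simp add: add.assoc)
  also have "\<dots> = mean_cost x + expectation (\<lambda>\<omega>. (1 - \<alpha>) * cbar * (x - D 1 \<omega>) + cbar * \<mu>)"
    unfolding mean_cost_def using Eh_integrable D_integrable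
    by (intro Bochner_Integration.integral_add) auto
  also have "expectation (\<lambda>\<omega>. (1 - \<alpha>) * cbar * (x - D 1 \<omega>) + cbar * \<mu>)
      = (1 - \<alpha>) * cbar * (x - \<mu>) + cbar * \<mu>"
    using D_integrable by (simp add: prob_space)
  finally show ?thesis by simp
qed

lemma continuous_Eh_disc: "continuous_on UNIV (Eh_disc \<alpha>)"
  unfolding Eh_disc_eq[abs_def] by (intro continuous_intros continuous_mean_cost)

lemma mean_cost_large:
  obtains b where "\<And>x. \<bar>x\<bar> \<ge> b \<Longrightarrow> mean_cost x > C"
proof -
  have "eventually (\<lambda>x. mean_cost x > C) at_infinity"
    using Eh_coercive unfolding filterlim_at_top_dense mean_cost_def by blast
  then show ?thesis using that by (auto simp: eventually_at_infinity)
qed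

text \<open>For positive \<open>x\<close> the linear term has the favourable sign, so coercivity of
  \<open>mean_cost\<close> carries over to the right.\<close>

lemma Eh_disc_large:
  assumes "\<alpha> \<le> 1"
  obtains b where "b \<ge> b0" "\<And>x. x \<ge> b \<Longrightarrow> Eh_disc \<alpha> x > C"
proof -
  obtain b where b: "\<And>x. \<bar>x\<bar> \<ge> b \<Longrightarrow> mean_cost x > C + (1 - \<alpha>) * cbar * \<mu>" using mean_cost_large by metis
  have "Eh_disc \<alpha> x > C" if "x \<ge> max b0 (max b 0)" for x
  proof -
    have "0 \<le> (1 - \<alpha>) * cbar * x" "0 \<le> cbar * \<mu>" using assms that cbar_pos \<mu>_nonneg by auto
    then show ?thesis using b[of x] that by (simp add: Eh_disc_eq algebra_simps)
  qed
  then show ?thesis using that[of "max b0 (max b 0)"] by auto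
qed

text \<open>At the correct level this is the relative value function up to the term
  \<open>cbar * x\<close> and a constant.\<close>

abbreviation relative_value :: "real \<Rightarrow> real \<Rightarrow> real \<Rightarrow> real" where
  "relative_value \<alpha> g \<equiv> renewal \<alpha> (excess (Eh_disc \<alpha>) g)"

lemma renewal_nonpos:
  assumes \<psi>: "left_null a \<psi>" and \<alpha>: "0 \<le> \<alpha>" "\<alpha> \<le> 1" and le: "\<And>y. y \<le> x \<Longrightarrow> \<psi> y \<le> 0"
  shows "renewal \<alpha> \<psi> x \<le> 0"
proof (rule renewal_maximum_principle[where f="renewal \<alpha> \<psi>" and x=x and B=x and b=a and \<alpha>=\<alpha>])
  show "renewal \<alpha> \<psi> y \<le> \<alpha> * demand_mean (renewal \<alpha> \<psi>) y" if "y \<le> x" for y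
    using renewal_eq[OF \<psi> \<alpha>, of y] le[OF that] by simp
qed (use \<alpha> left_null_renewal[OF \<psi> \<alpha>] left_bounded_renewal[OF \<psi> \<alpha>] in \<open>auto simp: left_null_def\<close>)

text \<open>The maximum principle for the negated solution: a nonnegative source beyond
  \<open>b\<close> cannot push it below a lower bound valid up to \<open>b\<close>.\<close>

lemma renewal_ge_if_nonneg_right:
  assumes \<psi>: "left_null a \<psi>" and \<alpha>: "0 \<le> \<alpha>" "\<alpha> \<le> 1" and C: "0 \<le> C"
    and left: "\<And>y. y \<le> b \<Longrightarrow> renewal \<alpha> \<psi> y \<ge> - C" and nonneg: "\<And>y. b < y \<Longrightarrow> \<psi> y \<ge> 0"
  shows "renewal \<alpha> \<psi> x \<ge> - C"
proof -
  have "- renewal \<alpha> \<psi> x \<le> C"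
  proof (rule renewal_maximum_principle[where f="\<lambda>x. - renewal \<alpha> \<psi> x" and x=x and B=x and b=b and \<alpha>=\<alpha>])
    show "left_bounded (\<lambda>x. - renewal \<alpha> \<psi> x)"
      using left_bounded_cmult[OF left_bounded_renewal[OF \<psi> \<alpha>], of "-1"] by simp
    show "- renewal \<alpha> \<psi> y \<le> \<alpha> * demand_mean (\<lambda>x. - renewal \<alpha> \<psi> x) y" if "b < y" for y
      using renewal_eq[OF \<psi> \<alpha>, of y] nonneg[OF that] demand_mean_cmult[of "-1" "renewal \<alpha> \<psi>" y] by simp
  qed (use \<alpha> C left in force)+
  then show ?thesis by simp
qed

text \<open>The minimum over \<open>{a..B}\<close> is Lipschitz in \<open>g\<close>, nonnegative at
  the level of the minimum of \<open>Eh_disc \<alpha>\<close>, and at most \<open>- K\<close> when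
  the level is higher by \<open>K\<close>. The intermediate value theorem yields
  \<open>g\<close>.\<close>

lemma exists_optimal_level:
  assumes \<alpha>: "0 \<le> \<alpha>" "\<alpha> \<le> 1" and qc: "quasiconvex (Eh_disc \<alpha>)"
    and x0: "\<And>y. Eh_disc \<alpha> x0 \<le> Eh_disc \<alpha> y" and a: "a \<le> x0" "K + Eh_disc \<alpha> x0 < Eh_disc \<alpha> a"
  obtains g S where "Eh_disc \<alpha> x0 \<le> g" "g \<le> K + Eh_disc \<alpha> x0"
    "relative_value \<alpha> g S = - K" "\<And>x. - K \<le> relative_value \<alpha> g x"
proof -
  define G where "G = Eh_disc \<alpha>"
  define m where "m = G x0"
  define \<phi> where "\<phi> g = renewal \<alpha> (excess G g)" for g
  note qc = qc[folded G_def]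
  have cont: "continuous_on UNIV G" unfolding G_def by (rule continuous_Eh_disc)
  \<comment> \<open>Every level considered lies below \<open>G a\<close>, so one \<open>a\<close>
    serves all of them.\<close>
  have \<psi>: "left_null a (excess G g)" if "g \<in> {m..m + K}" for g
    using that a x0 unfolding G_def[symmetric]
    by (intro left_null_excess[where p=x0] qc cont) (auto simp: m_def)
  obtain B where B: "B \<ge> x0" "\<And>x. x \<ge> B \<Longrightarrow> G x > m + K"
    using Eh_disc_large[OF \<alpha>(2)] unfolding G_def by metis
  have aB: "a \<le> B" using a B by simp
  have \<phi>c: "continuous_on {a..B} (\<phi> g)" if "g \<in> {m..m + K}" for g
    using left_null_renewal[OF \<psi>[OF that] \<alpha>] continuous_on_subset unfolding left_null_def \<phi>_def by blast
  have attained: "\<exists>x\<in>{a..B}. \<forall>y\<in>{a..B}. \<phi> g x \<le> \<phi> g y" if "g \<in> {m..m + K}" for g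
    using continuous_attains_inf[OF compact_Icc _ \<phi>c[OF that]] aB by auto
  define \<kappa> where "\<kappa> g = (INF x\<in>{a..B}. \<phi> g x)" for g
  have bdd: "bdd_below (\<phi> g ` {a..B})" if "g \<in> {m..m + K}" for g
    using attained[OF that] by (auto simp: bdd_below_def)
  define C where "C = exp (B - a) / (1 - \<theta>)"
  have C0: "0 \<le> C" using \<theta>_less_1 by (simp add: C_def)
  \<comment> \<open>Both discount factors are \<open>\<alpha>\<close>, so the constant
    \<open>c\<close> of \<open>renewal_stable\<close> is multiplied by zero.\<close>
  have lip: "\<bar>\<phi> g x - \<phi> g' x\<bar> \<le> C * \<bar>g - g'\<bar>" if g: "g \<in> {m..m + K}" "g' \<in> {m..m + K}" and "x \<le> B" for g g' x
  proof -
    obtain c where c: "\<And>y. y \<le> B \<Longrightarrow> \<bar>\<phi> g' y\<bar> \<le> c"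
      using left_boundedD[OF left_bounded_renewal[OF \<psi>[OF g(2)] \<alpha>]] unfolding \<phi>_def by metis
    have "\<bar>\<phi> g x - \<phi> g' x\<bar> \<le> (\<bar>g - g'\<bar> + \<bar>\<alpha> - \<alpha>\<bar> * c) * exp (B - a) / (1 - \<theta>)"
      unfolding \<phi>_def
    proof (rule renewal_stable[OF \<psi>[OF g(1)] \<psi>[OF g(2)] \<alpha> \<alpha> _ _ that(3)])
      show "\<bar>excess G g y - excess G g' y\<bar> \<le> \<bar>g - g'\<bar>" for y
        using excess_diff_le[OF qc, of x0 g G g' y] qc g by (simp add: m_def)
      show "\<bar>renewal \<alpha> (excess G g') y\<bar> \<le> c" if "y \<le> B" for y
        using c[OF that] by (simp add: \<phi>_def)
    qed
    then show ?thesis by (simp add: C_def mult_ac)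
  qed
  have \<kappa>_le: "\<kappa> g \<le> \<kappa> g' + C * \<bar>g - g'\<bar>" if g: "g \<in> {m..m + K}" "g' \<in> {m..m + K}" for g g'
  proof -
    have "\<kappa> g - C * \<bar>g - g'\<bar> \<le> \<kappa> g'"
      unfolding \<kappa>_def[of g']
    proof (rule cINF_greatest)
      fix x assume x: "x \<in> {a..B}"
      have "\<kappa> g \<le> \<phi> g x" unfolding \<kappa>_def by (rule cINF_lower[OF bdd[OF g(1)] x])
      with lip[OF g, of x] x show "\<kappa> g - C * \<bar>g - g'\<bar> \<le> \<phi> g' x" by auto
    qed (use aB in auto)
    then show ?thesis by simp
  qed
  have "C-lipschitz_on {m..m + K} \<kappa>"
  proof (rule lipschitz_onI)
    fix g g' assume "g \<in> {m..m + K}" "g' \<in> {m..m + K}"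
    from \<kappa>_le[OF this] \<kappa>_le[OF this(2,1)] show "dist (\<kappa> g) (\<kappa> g') \<le> C * dist g g'"
      by (simp add: dist_real_def abs_minus_commute)
  qed (rule C0)
  then have \<kappa>_cont: "continuous_on {m..m + K} \<kappa>" by (rule lipschitz_on_continuous_on)
  have "0 \<le> \<kappa> m"
    unfolding \<kappa>_def
  proof (rule cINF_greatest)
    fix x assume "x \<in> {a..B}"
    have m: "m \<in> {m..m + K}" using K_pos by simp
    have "renewal \<alpha> (excess G m) x \<ge> - 0"
    proof (rule renewal_ge_if_nonneg_right[OF \<psi>[OF m] \<alpha>])
      show "renewal \<alpha> (excess G m) y \<ge> - 0" if "y \<le> a" for y
        using left_null_renewal[OF \<psi>[OF m] \<alpha>] that by (simp add: left_null_def)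
      show "excess G m y \<ge> 0" for y
        using x0 by (simp add: excess_def m_def G_def)
    qed simp
    then show "0 \<le> \<phi> m x" by (simp add: \<phi>_def)
  qed (use aB in auto)
  \<comment> \<open>At \<open>x0\<close> the source equals \<open>- K\<close>, and the averaged term
    is nonpositive because the solution is nonpositive up to \<open>x0\<close>.\<close>
  moreover have "\<kappa> (m + K) \<le> - K"
  proof -
    have g: "m + K \<in> {m..m + K}" using K_pos by simp
    have np: "\<phi> (m + K) y \<le> 0" if "y \<le> x0" for y
      unfolding \<phi>_def
      by (rule renewal_nonpos[OF \<psi>[OF g] \<alpha>]) (use that K_pos in \<open>auto simp: excess_cut[OF qc, of x0] m_def\<close>)
    have lb: "left_bounded (\<phi> (m + K))" unfolding \<phi>_def by (rule left_bounded_renewal[OF \<psi>[OF g] \<alpha>])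
    have "demand_mean (\<phi> (m + K)) x0 \<le> demand_mean (\<lambda>_. 0) x0"
      by (intro demand_mean_mono lb left_bounded_const np)
    then have "\<alpha> * demand_mean (\<phi> (m + K)) x0 \<le> 0" using \<alpha> by (simp add: mult_nonneg_nonpos)
    moreover have "\<phi> (m + K) x0 = excess G (m + K) x0 + \<alpha> * demand_mean (\<phi> (m + K)) x0"
      unfolding \<phi>_def by (rule renewal_eq[OF \<psi>[OF g] \<alpha>])
    moreover have "excess G (m + K) x0 = - K"
      using K_pos by (simp add: excess_cut[OF qc, of x0] m_def)
    ultimately have "\<phi> (m + K) x0 \<le> - K" by simp
    moreover have "\<kappa> (m + K) \<le> \<phi> (m + K) x0"
      unfolding \<kappa>_def by (rule cINF_lower[OF bdd[OF g]]) (use a B in auto)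
    ultimately show ?thesis by simp
  qed
  ultimately obtain g where g: "g \<in> {m..m + K}" "\<kappa> g = - K"
    using IVT2'[of \<kappa> "m + K" "- K" m] \<kappa>_cont K_pos by auto
  obtain S where S: "S \<in> {a..B}" "\<And>y. y \<in> {a..B} \<Longrightarrow> \<phi> g S \<le> \<phi> g y"
    using attained[OF g(1)] by auto
  have \<phi>S: "\<phi> g S = - K"
    using cINF_lower[OF bdd[OF g(1)] S(1)] cINF_greatest[of "{a..B}" "\<phi> g S" "\<phi> g"] S aB g(2)
    by (fastforce simp: \<kappa>_def)
  \<comment> \<open>Beyond \<open>B\<close> the source is nonnegative, so the minimum over
    \<open>{a..B}\<close> is global.\<close>
  have "renewal \<alpha> (excess G g) x \<ge> - K" for x
  proof (rule renewal_ge_if_nonneg_right[OF \<psi>[OF g(1)] \<alpha>, where b=B])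
    show "renewal \<alpha> (excess G g) y \<ge> - K" if "y \<le> B" for y
    proof (cases "y \<le> a")
      case True
      then show ?thesis using left_null_renewal[OF \<psi>[OF g(1)] \<alpha>] K_pos by (simp add: left_null_def)
    next
      case False
      then show ?thesis using S(2)[of y] that \<phi>S by (simp add: \<phi>_def)
    qed
    show "excess G g y \<ge> 0" if "B < y" for y
      using B(2)[of y] that g(1) by (simp add: excess_def)
  qed (use K_pos in simp)
  then show ?thesis
    using that[of g S] g(1) \<phi>S unfolding G_def \<phi>_def m_def by auto
qed

text \<open>The source vanishes up to \<open>x\<close>, so \<open>x\<close> itself serves as
  threshold for \<open>left_null\<close>.\<close>

lemma relative_value_eq_0:
  assumes \<alpha>: "0 \<le> \<alpha>" "\<alpha> \<le> 1" and \<psi>: "left_null a (excess (Eh_disc \<alpha>) g)"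
    and nr: "\<not> (\<exists>y\<le>x. Eh_disc \<alpha> y \<le> g)"
  shows "relative_value \<alpha> g x = 0"
proof -
  have "excess (Eh_disc \<alpha>) g z = 0" if "z \<le> x" for z
    using that nr by (auto simp: excess_def)
  with \<psi> have "left_null x (excess (Eh_disc \<alpha>) g)" by (auto simp: left_null_def)
  from left_null_renewal[OF this \<alpha>] show ?thesis by (simp add: left_null_def)
qed

end

section \<open>Optimality of (s, S) policies\<close>

context inventory_model
begin

text \<open>A nonconstant affine function is not left bounded; its part is handled by the finite
  mean of the demand.\<close>

lemma integrable_affine_shift:
  assumes "left_bounded f"
  shows "integrable M (\<lambda>\<omega>. f (x - D 1 \<omega>) + r - s * (x - D 1 \<omega>))"
  using integrable_demand_shift[OF assms] D_integrable by simp

lemma expectation_affine_shift: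
  assumes "left_bounded f"
  shows "expectation (\<lambda>\<omega>. f (x - D 1 \<omega>) + r - s * (x - D 1 \<omega>)) = demand_mean f x + r - s * (x - \<mu>)"
proof -
  have "expectation (\<lambda>\<omega>. f (x - D 1 \<omega>) + (r - s * (x - D 1 \<omega>)))
      = demand_mean f x + expectation (\<lambda>\<omega>. r - s * (x - D 1 \<omega>))"
    unfolding demand_mean_def using integrable_demand_shift[OF assms] D_integrable
    by (intro Bochner_Integration.integral_add) auto
  also have "expectation (\<lambda>\<omega>. r - s * (x - D 1 \<omega>)) = r - s * (x - \<mu>)"
    using D_integrable by (simp add: prob_space)
  finally show ?thesis by (simp add: algebra_simps)
qed

end

text \<open>Here \<open>S\<close> becomes the order-up-to point, \<open>p\<close> marks where
  \<open>Eh_disc \<alpha>\<close> starts to be nondecreasing, and \<open>a\<close> lies to the left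
  of the reorder point.\<close>

locale optimal_level = inventory_model +
  fixes \<alpha> p a g S :: real
  assumes \<alpha>: "0 \<le> \<alpha>" "\<alpha> < 1" and qc: "quasiconvex (Eh_disc \<alpha>)"
    and p_min: "\<And>y. Eh_disc \<alpha> p \<le> Eh_disc \<alpha> y" and p_le: "Eh_disc \<alpha> p \<le> g"
    and a: "a \<le> p" "g < Eh_disc \<alpha> a"
    and S: "relative_value \<alpha> g S = - K" and ge_K: "\<And>x. - K \<le> relative_value \<alpha> g x"
begin

abbreviation \<phi> :: "real \<Rightarrow> real" where "\<phi> \<equiv> relative_value \<alpha> g"

text \<open>The candidate value function: the constant collects a charge of \<open>g\<close> per
  period, and \<open>cbar * x\<close> undoes the absorption of the unit ordering cost into
  \<open>h_disc\<close>.\<close>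

definition W :: "real \<Rightarrow> real" where "W x = \<phi> x + g / (1 - \<alpha>) - cbar * x"

lemma \<alpha>_le_1: "\<alpha> \<le> 1" using \<alpha> by simp

lemma left_null_\<psi>: "left_null a (excess (Eh_disc \<alpha>) g)"
  by (rule left_null_excess[where p=p, OF qc continuous_Eh_disc p_le a])

lemmas \<phi>_eq = renewal_eq[OF left_null_\<psi> \<alpha>(1) \<alpha>_le_1]
lemmas left_bounded_\<phi> = left_bounded_renewal[OF left_null_\<psi> \<alpha>(1) \<alpha>_le_1]
lemmas left_null_\<phi> = left_null_renewal[OF left_null_\<psi> \<alpha>(1) \<alpha>_le_1]

lemma \<phi>_nonpos: "x \<le> p \<Longrightarrow> \<phi> x \<le> 0"
  by (rule renewal_nonpos[OF left_null_\<psi> \<alpha>(1) \<alpha>_le_1]) (use p_le in \<open>auto simp: excess_cut[OF qc p_le]\<close>)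

lemma Eh_disc_mono: "p \<le> x \<Longrightarrow> x \<le> y \<Longrightarrow> Eh_disc \<alpha> x \<le> Eh_disc \<alpha> y"
  using quasiconvex_between[OF qc, of p x y] p_min[of y] by auto

text \<open>The K-inequality behind optimality. Up to \<open>p\<close> it follows from
  \<open>\<phi> \<le> 0\<close> and \<open>- K \<le> \<phi>\<close>; beyond \<open>p\<close> the
  source is nondecreasing, so the maximum principle applies to the difference.\<close>

lemma \<phi>_le_shift:
  assumes "0 \<le> d"
  shows "\<phi> x \<le> K + \<phi> (x + d)"
proof -
  let ?f = "\<lambda>x. \<phi> x - \<phi> (x + d)"
  have lb: "left_bounded (\<lambda>x. \<phi> (x + d))" by (rule left_bounded_shift[OF left_bounded_\<phi>])
  have dm: "demand_mean (\<lambda>x. \<phi> (x + d)) y = demand_mean \<phi> (y + d)" for y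
    by (simp add: demand_mean_def algebra_simps)
  have "?f x \<le> K"
  proof (rule renewal_maximum_principle[where f="?f" and x=x and B=x and b=p and \<alpha>=\<alpha>])
    show "left_bounded ?f" by (intro left_bounded_diff left_bounded_\<phi> lb)
    show "?f y \<le> K" if "y \<le> p" for y using \<phi>_nonpos[OF that] ge_K[of "y + d"] by simp
    show "?f y \<le> \<alpha> * demand_mean ?f y" if "p < y" for y
      using \<phi>_eq[of y] \<phi>_eq[of "y + d"] that assms Eh_disc_mono[of y "y + d"]
      by (simp add: demand_mean_diff[OF left_bounded_\<phi> lb] dm algebra_simps excess_cut[OF qc p_le])
  qed (use \<alpha> K_pos in auto)
  then show ?thesis by simp
qed

text \<open>Comparison with \<open>u / (1 - \<alpha>)\<close>, the constant solution for a constant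
  source \<open>u\<close> that dominates the actual source up to \<open>x\<close>.\<close>

lemma \<phi>_upper: "\<phi> x \<le> max (Eh_disc \<alpha> x - g) 0 / (1 - \<alpha>)"
proof -
  define u where "u = max (Eh_disc \<alpha> x - g) 0"
  have u: "0 \<le> u" by (simp add: u_def)
  let ?f = "\<lambda>x. \<phi> x - u / (1 - \<alpha>)"
  have "?f x \<le> 0"
  proof (rule renewal_maximum_principle[where f="?f" and x=x and B=x and b=a and \<alpha>=\<alpha>])
    show "left_bounded ?f" by (intro left_bounded_diff left_bounded_\<phi> left_bounded_const)
    show "?f y \<le> 0" if "y \<le> a" for y
      using left_null_\<phi> that u \<alpha> by (simp add: left_null_def)
    show "?f y \<le> \<alpha> * demand_mean ?f y" if "y \<le> x" for y
    proof -
      have "excess (Eh_disc \<alpha>) g y \<le> u"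
        using that Eh_disc_mono[of y x] by (auto simp: excess_cut[OF qc p_le] u_def)
      moreover have "u - u / (1 - \<alpha>) = - (\<alpha> * (u / (1 - \<alpha>)))" using \<alpha> by (simp add: field_simps)
      moreover have "\<phi> y - u / (1 - \<alpha>) = excess (Eh_disc \<alpha>) g y - u / (1 - \<alpha>) + \<alpha> * demand_mean \<phi> y"
        using \<phi>_eq[of y] by simp
      ultimately have "\<phi> y - u / (1 - \<alpha>) \<le> \<alpha> * demand_mean \<phi> y - \<alpha> * (u / (1 - \<alpha>))" by linarith
      also have "\<dots> = \<alpha> * demand_mean ?f y"
        by (simp add: demand_mean_diff[OF left_bounded_\<phi> left_bounded_const] right_diff_distrib)
      finally show ?thesis .
    qed
  qed (use \<alpha> in auto)
  then show ?thesis by (simp add: u_def)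
qed

lemma integrable_W: "integrable M (\<lambda>\<omega>. W (x - D 1 \<omega>))"
  unfolding W_def by (rule integrable_affine_shift[OF left_bounded_\<phi>])

lemma expectation_W: "expectation (\<lambda>\<omega>. W (x - D 1 \<omega>)) = demand_mean \<phi> x + g / (1 - \<alpha>) - cbar * (x - \<mu>)"
  unfolding W_def by (rule expectation_affine_shift[OF left_bounded_\<phi>])

lemma bellman_rhs:
  "cost x b + \<alpha> * expectation (\<lambda>\<omega>. W (x + b - D 1 \<omega>)) =
    (if b > 0 then K else 0) + (Eh_disc \<alpha> (x + b) - g + \<alpha> * demand_mean \<phi> (x + b))
      + g / (1 - \<alpha>) - cbar * x"
proof -
  \<comment> \<open>The constant in \<open>W\<close> is the fixed point of adding \<open>g\<close>
    after discounting.\<close>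
  have "g / (1 - \<alpha>) = g + \<alpha> * (g / (1 - \<alpha>))" using \<alpha> by (simp add: field_simps)
  then have *: "\<alpha> * (g / (1 - \<alpha>)) = g / (1 - \<alpha>) - g" by linarith
  show ?thesis
    unfolding expectation_W cost_eq Eh_disc_eq distrib_left right_diff_distrib *
    by (simp add: algebra_simps)
qed

text \<open>Left of the reorder point the source is zero while \<open>Eh_disc \<alpha>\<close>
  exceeds \<open>g\<close>; elsewhere it is \<open>Eh_disc \<alpha> y - g\<close>. The rest is the
  K-inequality.\<close>

lemma bellman_le:
  assumes "0 \<le> b"
  shows "W x \<le> cost x b + \<alpha> * expectation (\<lambda>\<omega>. W (x + b - D 1 \<omega>))"
proof -
  have le: "\<phi> y \<le> Eh_disc \<alpha> y - g + \<alpha> * demand_mean \<phi> y" for y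
    using \<phi>_eq[of y] by (auto simp: excess_cut[OF qc p_le] split: if_splits)
  have "\<phi> x \<le> (if b > 0 then K else 0) + \<phi> (x + b)"
    using \<phi>_le_shift[OF assms, of x] assms by auto
  with le[of "x + b"] show ?thesis unfolding bellman_rhs unfolding W_def by simp
qed

text \<open>The (s, S) rule, with s the leftmost point of the sublevel set; testing the sublevel set
  directly avoids naming s.\<close>

definition order_amount :: "real \<Rightarrow> real" where
  "order_amount x = (if \<exists>y\<le>x. Eh_disc \<alpha> y \<le> g then 0 else S - x)"

lemmas \<phi>_eq_0 = relative_value_eq_0[OF \<alpha>(1) \<alpha>_le_1 left_null_\<psi>]

text \<open>Before the reorder point \<open>\<phi>\<close> is zero, whereas it is \<open>- K\<close>
  at \<open>S\<close>.\<close>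

lemma S_reached: "\<exists>y\<le>S. Eh_disc \<alpha> y \<le> g"
  using \<phi>_eq_0[of S] S K_pos by auto

lemma order_less: "\<not> (\<exists>y\<le>x. Eh_disc \<alpha> y \<le> g) \<Longrightarrow> x < S"
  using S_reached by (meson linorder_not_less order_trans)

lemma order_nonneg: "0 \<le> order_amount x"
  using order_less[of x] by (auto simp: order_amount_def)

text \<open>The states without an order form an interval, hence a Borel set.\<close>

lemma order_measurable: "order_amount \<in> borel_measurable borel"
proof -
  have "is_interval {x. \<exists>y\<le>x. Eh_disc \<alpha> y \<le> g}"
    unfolding is_interval_1 by (auto intro: order_trans)
  then have [measurable]: "Measurable.pred borel (\<lambda>x. \<exists>y\<le>x. Eh_disc \<alpha> y \<le> g)"
    using real_interval_borel_measurable by (simp add: pred_def)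
  show ?thesis unfolding order_amount_def by measurable
qed

text \<open>Without an order this is the renewal equation. With an order,
  \<open>K + \<phi> S\<close> is zero, which is also the value of \<open>\<phi>\<close> at
  \<open>x\<close>.\<close>

lemma bellman_order: "cost x (order_amount x) + \<alpha> * expectation (\<lambda>\<omega>. W (x + order_amount x - D 1 \<omega>)) = W x"
proof -
  have eq: "Eh_disc \<alpha> y - g + \<alpha> * demand_mean \<phi> y = \<phi> y" if "\<exists>z\<le>y. Eh_disc \<alpha> z \<le> g" for y
    using \<phi>_eq[of y] that unfolding excess_def by (simp only: if_True)
  show ?thesis
  proof (cases "\<exists>y\<le>x. Eh_disc \<alpha> y \<le> g")
    case True
    then have "order_amount x = 0" unfolding order_amount_def by (simp only: if_True)
    with eq[OF True] show ?thesis unfolding bellman_rhs unfolding W_def by simp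
  next
    case False
    then have "order_amount x = S - x" unfolding order_amount_def by (simp only: if_False)
    with eq[OF S_reached] order_less[OF False] S \<phi>_eq_0[OF False] show ?thesis
      unfolding bellman_rhs unfolding W_def by simp
  qed
qed

text \<open>Ensures that \<open>ennreal\<close> does not truncate \<open>W\<close>. On a left
  half-line invariant under the rule, the infimum \<open>w\<close> satisfies
  \<open>\<alpha> * w \<le> w\<close> because costs are nonnegative.\<close>

lemma W_nonneg: "0 \<le> W x"
proof -
  \<comment> \<open>Orders end at \<open>S\<close> and demand only lowers the state, so
    \<open>{..B}\<close> is never left.\<close>
  define B where "B = max x S"
  obtain c where c: "\<And>y. y \<le> B \<Longrightarrow> \<bar>\<phi> y\<bar> \<le> c" using left_boundedD[OF left_bounded_\<phi>] by metis
  define w where "w = (INF y\<in>{..B}. W y)"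
  have bdd: "bdd_below (W ` {..B})"
  proof (intro bdd_belowI2)
    fix y assume "y \<in> {..B}"
    then have "cbar * y \<le> cbar * B" "- c \<le> \<phi> y" using cbar_pos c[of y] by auto
    then show "- c + g / (1 - \<alpha>) - cbar * B \<le> W y" by (simp add: W_def)
  qed
  have w: "w \<le> W y" if "y \<le> B" for y
    unfolding w_def by (rule cINF_lower[OF bdd]) (use that in auto)
  have "\<alpha> * w \<le> (INF y\<in>{..B}. W y)"
  proof (rule cINF_greatest)
    fix y assume y: "y \<in> {..B}"
    have le: "y + order_amount y \<le> B" using y unfolding order_amount_def by (auto simp: B_def)
    have "w = expectation (\<lambda>\<omega>. w)" by (simp add: prob_space)
    also have "\<dots> \<le> expectation (\<lambda>\<omega>. W (y + order_amount y - D 1 \<omega>))"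
    proof (rule integral_mono)
      fix \<omega> assume "\<omega> \<in> space M"
      with D1_nonneg[of \<omega>] le show "w \<le> W (y + order_amount y - D 1 \<omega>)" by (intro w) auto
    qed (use integrable_W in auto)
    finally have "\<alpha> * w \<le> \<alpha> * expectation (\<lambda>\<omega>. W (y + order_amount y - D 1 \<omega>))"
      using \<alpha> by (intro mult_left_mono) auto
    with bellman_order[of y] cost_nonneg[OF order_nonneg, of y y] show "\<alpha> * w \<le> W y" by linarith
  qed auto
  then have "0 \<le> (1 - \<alpha>) * w" by (simp add: w_def algebra_simps)
  then have "0 \<le> w" using \<alpha> by (simp add: zero_le_mult_iff)
  also have "\<dots> \<le> W x" by (rule w) (simp add: B_def)
  finally show ?thesis .
qed

text \<open>Supplies the growth hypothesis of \<open>le_disc_cost\<close>.\<close>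

lemma W_growth:
  obtains c1 c2 where "0 \<le> c1" "0 \<le> c2" "\<And>x b. 0 \<le> b \<Longrightarrow> W x \<le> c1 + c2 * cost x b"
proof -
  define r where "r = 1 / (1 - \<alpha>)"
  have r: "1 \<le> r" "0 \<le> r" using \<alpha> by (auto simp: r_def)
  have r1: "r * ((1 - \<alpha>) * z) = z" for z using \<alpha> by (simp add: r_def)
  define m where "m = Eh_disc \<alpha> p"
  define c where "c = cbar * \<mu> + \<bar>g\<bar> + \<bar>m\<bar>"
  have cmu: "0 \<le> cbar * \<mu>" "0 \<le> \<alpha> * (cbar * \<mu>)" "\<alpha> * (cbar * \<mu>) \<le> cbar * \<mu>"
    using cbar_pos \<mu>_nonneg \<alpha> by (auto simp: mult_left_le_one_le)
  have c0: "0 \<le> c" using cmu by (simp add: c_def)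
  \<comment> \<open>Where \<open>Eh_disc \<alpha> y \<le> g\<close>, \<open>\<phi>\<close> is
    nonpositive and minimality of \<open>p\<close> controls \<open>- cbar * y\<close>; elsewhere
    \<open>\<phi>_upper\<close> applies.\<close>
  have key: "\<phi> y - cbar * y \<le> r * (mean_cost y + c)" for y
  proof (cases "Eh_disc \<alpha> y - g \<le> 0")
    case True
    have "\<phi> y \<le> 0" using \<phi>_upper[of y] True by simp
    have "(1 - \<alpha>) * (- (cbar * y)) \<le> mean_cost y + \<alpha> * (cbar * \<mu>) - m"
      using p_min[of y] unfolding m_def[symmetric] by (simp add: Eh_disc_eq algebra_simps)
    also have "\<dots> \<le> mean_cost y + c" using cmu by (simp add: c_def)
    finally have "r * ((1 - \<alpha>) * (- (cbar * y))) \<le> r * (mean_cost y + c)" using r by (intro mult_left_mono) auto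
    then show ?thesis unfolding r1 using \<open>\<phi> y \<le> 0\<close> by simp
  next
    case False
    have "\<phi> y \<le> r * (Eh_disc \<alpha> y - g)" using \<phi>_upper[of y] False by (simp add: r_def)
    moreover have "r * (Eh_disc \<alpha> y - g) - cbar * y = r * (Eh_disc \<alpha> y - g - (1 - \<alpha>) * (cbar * y))"
      using r1[of "cbar * y"] by (simp add: right_diff_distrib)
    moreover have "r * (Eh_disc \<alpha> y - g - (1 - \<alpha>) * (cbar * y)) \<le> r * (mean_cost y + c)"
    proof (rule mult_left_mono)
      have "Eh_disc \<alpha> y - g - (1 - \<alpha>) * (cbar * y) = mean_cost y + \<alpha> * (cbar * \<mu>) - g"
        by (simp add: Eh_disc_eq algebra_simps)
      then show "Eh_disc \<alpha> y - g - (1 - \<alpha>) * (cbar * y) \<le> mean_cost y + c" using cmu by (simp add: c_def)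
    qed (use r in auto)
    ultimately show ?thesis by linarith
  qed
  define c1 where "c1 = K + \<bar>g / (1 - \<alpha>)\<bar> + r * c"
  have "W x \<le> c1 + r * cost x b" if b: "0 \<le> b" for x b
  proof -
    have le: "cbar * b \<le> r * (cbar * b)"
      using mult_right_mono[OF r(1), of "cbar * b"] b cbar_pos by simp
    \<comment> \<open>The cost of ordering \<open>b\<close> involves
      \<open>mean_cost (x + b)\<close>, so the K-inequality first moves to
      \<open>x + b\<close>.\<close>
    have "W x \<le> K + \<phi> (x + b) + g / (1 - \<alpha>) - cbar * x"
      using \<phi>_le_shift[OF b, of x] by (simp add: W_def)
    also have "\<dots> = K + g / (1 - \<alpha>) + cbar * b + (\<phi> (x + b) - cbar * (x + b))"
      by (simp add: algebra_simps)
    also have "\<dots> \<le> K + \<bar>g / (1 - \<alpha>)\<bar> + r * (cbar * b) + r * (mean_cost (x + b) + c)"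
      using key[of "x + b"] abs_ge_self[of "g / (1 - \<alpha>)"] le by linarith
    also have "\<dots> = c1 + r * (cbar * b + mean_cost (x + b))"
      by (simp add: c1_def algebra_simps)
    also have "\<dots> \<le> c1 + r * cost x b"
      using r K_pos by (intro add_left_mono mult_left_mono) (auto simp: cost_eq)
    finally show ?thesis .
  qed
  then show ?thesis using that[of c1 r] r c0 K_pos by (simp add: c1_def)
qed

lemma W_measurable: "W \<in> borel_measurable borel"
  using left_bounded_measurable[OF left_bounded_\<phi>] unfolding W_def by measurable

lemma nn_integral_W: "(\<integral>\<^sup>+\<omega>. ennreal (W (x - D 1 \<omega>)) \<partial>M) = ennreal (expectation (\<lambda>\<omega>. W (x - D 1 \<omega>)))"
  by (rule nn_integral_eq_integral[OF integrable_W]) (simp add: W_nonneg)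

lemma bellman_ennreal:
  assumes "0 \<le> b"
  shows "ennreal (cost x b) + ennreal \<alpha> * (\<integral>\<^sup>+\<omega>. ennreal (W (x + b - D 1 \<omega>)) \<partial>M)
    = ennreal (cost x b + \<alpha> * expectation (\<lambda>\<omega>. W (x + b - D 1 \<omega>)))"
proof -
  have "0 \<le> expectation (\<lambda>\<omega>. W (x + b - D 1 \<omega>))"
    by (rule integral_nonneg_AE) (simp add: W_nonneg)
  then show ?thesis
    unfolding nn_integral_W using \<alpha> cost_nonneg[OF assms] by (simp add: ennreal_mult)
qed

text \<open>The (s, S) policy gives the upper bound, the optimality inequality over all policies the
  lower one.\<close>

lemma v_eq: "v \<alpha> x = ennreal (W x)"
proof (rule antisym)
  have "v \<alpha> x \<le> disc_cost \<alpha> (markov_policy order_amount) x"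
    unfolding v_def by (rule INF_lower[OF markov_policy_in_policies[OF order_measurable order_nonneg]])
  also have "\<dots> \<le> ennreal (W x)"
    by (rule disc_cost_markov_policy_le[OF order_measurable order_nonneg \<alpha>(1) W_measurable])
      (simp only: bellman_ennreal[OF order_nonneg] bellman_order order_refl)
  finally show "v \<alpha> x \<le> ennreal (W x)" .
  obtain c1 c2 where c: "0 \<le> c1" "0 \<le> c2" "\<And>x b. 0 \<le> b \<Longrightarrow> W x \<le> c1 + c2 * cost x b"
    using W_growth by metis
  show "ennreal (W x) \<le> v \<alpha> x"
    unfolding v_def
  proof (rule INF_greatest)
    fix \<pi> assume "\<pi> \<in> policies"
    then show "ennreal (W x) \<le> disc_cost \<alpha> \<pi> x"
      by (rule le_disc_cost[OF _ \<alpha> W_measurable c(1,2)])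
        (use c(3) in \<open>auto simp only: bellman_ennreal intro!: ennreal_leI bellman_le\<close>)
  qed
qed

text \<open>The constant \<open>g / (1 - \<alpha>)\<close> cancels once the minimum is located at
  \<open>z\<close>.\<close>

lemma u_disc_eq:
  assumes "\<And>y. \<phi> z - cbar * z \<le> \<phi> y - cbar * y"
  shows "u_disc \<alpha> x = ereal ((\<phi> x - cbar * x) - (\<phi> z - cbar * z))"
proof -
  have "m \<alpha> = ennreal (W z)"
    unfolding m_def v_eq
    by (rule antisym[OF INF_lower INF_greatest]) (use assms in \<open>auto intro!: ennreal_leI simp: W_def algebra_simps\<close>)
  then show ?thesis
    by (simp add: u_disc_def v_eq enn2ereal_ennreal W_nonneg) (simp add: W_def)
qed

end

section \<open>The vanishing discount limit\<close>

context inventory_model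
begin

lemma tendsto_Eh_disc: "((\<lambda>\<alpha>. Eh_disc \<alpha> x) \<longlongrightarrow> Eh_disc 1 x) (at_left 1)"
  unfolding Eh_disc_eq by (auto intro!: tendsto_eq_intros)

text \<open>Compactness gives a minimizer on \<open>{a..B}\<close>. Left of \<open>a\<close> the
  function is \<open>- cbar * y\<close>, and right of \<open>B\<close> large holding costs exclude
  lower values, again by the maximum principle.\<close>

lemma relative_value_attains_inf:
  assumes \<alpha>: "0 \<le> \<alpha>" "\<alpha> \<le> 1" and \<psi>: "left_null a (excess (Eh_disc \<alpha>) g)"
    and qc: "quasiconvex (Eh_disc \<alpha>)" and p: "Eh_disc \<alpha> p \<le> g" "a \<le> p" "p \<le> B"
    and B: "\<And>y. B < y \<Longrightarrow> g + cbar * \<bar>p\<bar> \<le> mean_cost y"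
  obtains z where "z \<in> {a..B}" "\<And>y. relative_value \<alpha> g z - cbar * z \<le> relative_value \<alpha> g y - cbar * y"
proof -
  let ?\<phi> = "relative_value \<alpha> g"
  define w where "w x = ?\<phi> x - cbar * x" for x
  note ln = left_null_renewal[OF \<psi> \<alpha>] and lb = left_bounded_renewal[OF \<psi> \<alpha>]
  have w_cont: "continuous_on UNIV w"
    using ln unfolding w_def left_null_def by (intro continuous_intros) auto
  obtain z where z: "z \<in> {a..B}" "\<And>y. y \<in> {a..B} \<Longrightarrow> w z \<le> w y"
    using continuous_attains_inf[OF compact_Icc _ continuous_on_subset[OF w_cont], of a B] p by auto
  have left: "w z \<le> w y" if "y \<le> B" for y
  proof (cases "y < a")
    case True
    have "w z \<le> w a" using p by (intro z(2)) auto
    also have "w a \<le> w y" using ln True cbar_pos by (simp add: left_null_def w_def)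
    finally show ?thesis .
  qed (use z(2) that in simp)
  have "?\<phi> p \<le> 0"
    by (rule renewal_nonpos[OF \<psi> \<alpha>]) (use p in \<open>auto simp: excess_cut[OF qc p(1)]\<close>)
  moreover have "- (cbar * p) \<le> cbar * \<bar>p\<bar>"
    using cbar_pos by (simp add: abs_if)
  ultimately have "w z \<le> cbar * \<bar>p\<bar>" using left[OF p(3)] by (simp add: w_def)
  then have "(1 - \<alpha>) * w z \<le> (1 - \<alpha>) * (cbar * \<bar>p\<bar>)" using \<alpha> by (intro mult_left_mono) auto
  also have "\<dots> \<le> cbar * \<bar>p\<bar>" using \<alpha> cbar_pos by (intro mult_left_le_one_le) auto
  finally have wz: "(1 - \<alpha>) * w z \<le> cbar * \<bar>p\<bar>" .
  \<comment> \<open>The linear term keeps \<open>w z - w y\<close> from being left bounded; its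
    positive part vanishes up to \<open>B\<close>.\<close>
  let ?f = "\<lambda>y. max (w z - w y) 0"
  have "left_null B ?f"
    unfolding left_null_def
    by (intro conjI allI impI continuous_intros continuous_on_subset[OF w_cont]) (use left in auto)
  note lbf = left_null_left_bounded[OF this]
  have "?f y \<le> 0" for y
  proof (rule renewal_maximum_principle[where f="?f" and x=y and B=y and b=B and \<alpha>=\<alpha>, OF lbf])
    fix y assume y: "B < y"
    have int: "integrable M (\<lambda>\<omega>. w (y - D 1 \<omega>))"
      using integrable_affine_shift[OF lb, of y 0 cbar] by (simp add: w_def)
    have Ew: "expectation (\<lambda>\<omega>. w (y - D 1 \<omega>)) = demand_mean ?\<phi> y - cbar * (y - \<mu>)"
      using expectation_affine_shift[OF lb, of y 0 cbar] by (simp add: w_def)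
    have "?\<phi> y = Eh_disc \<alpha> y - g + \<alpha> * demand_mean ?\<phi> y"
      using renewal_eq[OF \<psi> \<alpha>, of y] y p by (simp add: excess_cut[OF qc p(1)])
    \<comment> \<open>Returning to the original costs: beyond \<open>B\<close> no order is placed,
      so only \<open>mean_cost y - g\<close> and the discounted mean remain.\<close>
    then have w_y: "w y = mean_cost y - g + \<alpha> * expectation (\<lambda>\<omega>. w (y - D 1 \<omega>))"
      unfolding Ew by (simp add: w_def Eh_disc_eq algebra_simps)
    have "expectation (\<lambda>\<omega>. w z - w (y - D 1 \<omega>)) \<le> demand_mean ?f y"
      unfolding demand_mean_def
      by (rule integral_mono) (use int integrable_demand_shift[OF lbf] in auto)
    moreover have "expectation (\<lambda>\<omega>. w z - w (y - D 1 \<omega>)) = w z - expectation (\<lambda>\<omega>. w (y - D 1 \<omega>))"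
      using int by (simp add: prob_space)
    ultimately have "\<alpha> * (w z - expectation (\<lambda>\<omega>. w (y - D 1 \<omega>))) \<le> \<alpha> * demand_mean ?f y"
      using \<alpha> by (intro mult_left_mono) auto
    then have "w z - w y \<le> \<alpha> * demand_mean ?f y"
      using w_y wz B[OF y] by (simp add: algebra_simps)
    moreover have "0 \<le> \<alpha> * demand_mean ?f y"
      using \<alpha> demand_mean_mono[OF left_bounded_const[of 0] lbf, of y] by simp
    ultimately show "?f y \<le> \<alpha> * demand_mean ?f y" by simp
  qed (use \<alpha> left in auto)
  then have "w z \<le> w y" for y by (metis diff_le_0_iff_le max.bounded_iff)
  with z(1) that show ?thesis by (simp add: w_def)
qed

text \<open>Where \<open>g\<close> is already reached, raising the level lowers the source by the
  full difference; monotonicity lowers the averaged term as well.\<close>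

lemma relative_value_strict_antimono:
  assumes \<alpha>: "0 \<le> \<alpha>" "\<alpha> \<le> 1" and qc: "quasiconvex (Eh_disc \<alpha>)" and p: "Eh_disc \<alpha> p \<le> g"
    and \<psi>: "left_null a (excess (Eh_disc \<alpha>) g)" "left_null a (excess (Eh_disc \<alpha>) g')"
    and le: "g \<le> g'" and reached: "\<exists>y\<le>x. Eh_disc \<alpha> y \<le> g"
  shows "relative_value \<alpha> g' x \<le> relative_value \<alpha> g x - (g' - g)"
proof -
  have "demand_mean (relative_value \<alpha> g') x \<le> demand_mean (relative_value \<alpha> g) x"
    using \<psi> \<alpha> by (intro demand_mean_mono left_bounded_renewal renewal_mono[of a] excess_antimono[OF qc p le])
  then have "\<alpha> * demand_mean (relative_value \<alpha> g') x \<le> \<alpha> * demand_mean (relative_value \<alpha> g) x"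
    using \<alpha> by (intro mult_left_mono)
  then show ?thesis
    using renewal_eq[OF \<psi>(1) \<alpha>, of x] renewal_eq[OF \<psi>(2) \<alpha>, of x] excess_shift[OF le reached] by simp
qed

end

section \<open>Gains for discount factors up to one\<close>

locale quasiconvex_inventory = inventory_model +
  fixes \<alpha>s :: real
  assumes \<alpha>s: "0 \<le> \<alpha>s" "\<alpha>s < 1"
    and quasiconv: "\<And>\<alpha>. \<alpha> \<in> {\<alpha>s<..1} \<Longrightarrow> quasiconvex (Eh_disc \<alpha>)"
    and limit_at_bot: "\<And>\<alpha>. \<alpha> \<in> {\<alpha>s<..1} \<Longrightarrow>
      \<exists>L. ((\<lambda>x. ereal (Eh_disc \<alpha> x)) \<longlongrightarrow> L) at_bot \<and>
          L > ereal K + (INF x. ereal (Eh_disc \<alpha> x))"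
begin

text \<open>Bundles with the level all witnesses that \<open>optimal_level\<close> asks for, and
  makes sense at \<open>\<alpha> = 1\<close>.\<close>

definition optimal_gain :: "real \<Rightarrow> real \<Rightarrow> bool" where
  "optimal_gain \<alpha> g \<longleftrightarrow> (\<exists>p a S. (\<forall>y. Eh_disc \<alpha> p \<le> Eh_disc \<alpha> y) \<and> Eh_disc \<alpha> p \<le> g \<and>
     a \<le> p \<and> g < Eh_disc \<alpha> a \<and> relative_value \<alpha> g S = - K \<and> (\<forall>x. - K \<le> relative_value \<alpha> g x))"

text \<open>The limit hypothesis provides a high point far left, coercivity one far right; in
  between, a minimum is attained.\<close>

lemma Eh_disc_minimizer:
  assumes "\<alpha> \<in> {\<alpha>s<..1}"
  obtains p a where "\<And>y. Eh_disc \<alpha> p \<le> Eh_disc \<alpha> y" "a \<le> p" "K + Eh_disc \<alpha> p < Eh_disc \<alpha> a"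
proof -
  obtain L where L: "((\<lambda>x. ereal (Eh_disc \<alpha> x)) \<longlongrightarrow> L) at_bot" "ereal K + (INF x. ereal (Eh_disc \<alpha> x)) < L"
    using limit_at_bot[OF assms] by blast
  \<comment> \<open>A real level strictly between the two sides of the limit hypothesis avoids
    arithmetic with infinite limits.\<close>
  have "\<exists>r. ereal r < L \<and> (\<exists>x. K + Eh_disc \<alpha> x < r)"
  proof -
    obtain l where l: "ereal K + (INF x. ereal (Eh_disc \<alpha> x)) < ereal l" "ereal l < L"
      using ereal_dense2[OF L(2)] by blast
    have "\<not> ereal (l - K) \<le> (INF x. ereal (Eh_disc \<alpha> x))"
      using l(1) add_left_mono[of "ereal (l - K)" "INF x. ereal (Eh_disc \<alpha> x)" "ereal K"] by auto
    then obtain x where "Eh_disc \<alpha> x < l - K"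
      unfolding le_INF_iff by (auto simp: not_le)
    with l(2) show ?thesis by (intro exI[of _ l] conjI exI[of _ x]) auto
  qed
  then obtain r x1 where r: "ereal r < L" and x1: "K + Eh_disc \<alpha> x1 < r" by blast
  from order_tendstoD(1)[OF L(1) r] obtain a where a: "\<And>x. x \<le> a \<Longrightarrow> r < Eh_disc \<alpha> x"
    by (auto simp: eventually_at_bot_linorder)
  obtain b where b: "\<And>x. x \<ge> b \<Longrightarrow> Eh_disc \<alpha> x > r"
    using Eh_disc_large[of \<alpha>] assms by (metis greaterThanAtMost_iff)
  have x1ab: "a \<le> x1" "x1 \<le> b" using a[of x1] b[of x1] x1 K_pos by (auto intro: ccontr)
  obtain p where p: "p \<in> {a..b}" "\<And>y. y \<in> {a..b} \<Longrightarrow> Eh_disc \<alpha> p \<le> Eh_disc \<alpha> y"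
    using continuous_attains_inf[OF compact_Icc _ continuous_on_subset[OF continuous_Eh_disc], of a b \<alpha>] x1ab
    by auto
  have less: "K + Eh_disc \<alpha> p < r" using p(2)[of x1] x1 x1ab by auto
  have "Eh_disc \<alpha> p \<le> Eh_disc \<alpha> y" for y
  proof (cases "y \<in> {a..b}")
    case False
    then have "r < Eh_disc \<alpha> y" using a[of y] b[of y] by (cases "y \<le> a") auto
    with less K_pos show ?thesis by simp
  qed (rule p(2))
  then show ?thesis using that[of p a] p(1) less a[OF order_refl] by auto
qed

lemma optimal_gain_exists:
  assumes "\<alpha> \<in> {\<alpha>s<..1}"
  shows "\<exists>g. optimal_gain \<alpha> g"
proof -
  obtain p a where pa: "\<And>y. Eh_disc \<alpha> p \<le> Eh_disc \<alpha> y" "a \<le> p" "K + Eh_disc \<alpha> p < Eh_disc \<alpha> a"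
    using Eh_disc_minimizer[OF assms] by metis
  have \<alpha>: "0 \<le> \<alpha>" "\<alpha> \<le> 1" using assms \<alpha>s by auto
  obtain g S where gS: "Eh_disc \<alpha> p \<le> g" "g \<le> K + Eh_disc \<alpha> p"
    "relative_value \<alpha> g S = - K" "\<And>x. - K \<le> relative_value \<alpha> g x"
    using exists_optimal_level[OF \<alpha> quasiconv[OF assms] pa] by blast
  have "g < Eh_disc \<alpha> a" using gS(2) pa(3) by linarith
  with pa(1,2) gS(1,3,4) show ?thesis unfolding optimal_gain_def by blast
qed

text \<open>Any selection of optimal levels will do; \<open>tendsto_gain\<close> is proved by
  comparison of levels.\<close>

definition gain :: "real \<Rightarrow> real" where "gain \<alpha> = (SOME g. optimal_gain \<alpha> g)"

lemma optimal_gain_gain: "\<alpha> \<in> {\<alpha>s<..1} \<Longrightarrow> optimal_gain \<alpha> (gain \<alpha>)"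
  unfolding gain_def by (rule someI_ex[OF optimal_gain_exists])

lemma gainE:
  assumes "\<alpha> \<in> {\<alpha>s<..1}"
  obtains p a S where "\<And>y. Eh_disc \<alpha> p \<le> Eh_disc \<alpha> y" "Eh_disc \<alpha> p \<le> gain \<alpha>"
    "a \<le> p" "gain \<alpha> < Eh_disc \<alpha> a" "left_null a (excess (Eh_disc \<alpha>) (gain \<alpha>))"
    "relative_value \<alpha> (gain \<alpha>) S = - K" "\<And>x. - K \<le> relative_value \<alpha> (gain \<alpha>) x"
proof -
  obtain p a S where *: "\<forall>y. Eh_disc \<alpha> p \<le> Eh_disc \<alpha> y" "Eh_disc \<alpha> p \<le> gain \<alpha>"
     "a \<le> p" "gain \<alpha> < Eh_disc \<alpha> a" "relative_value \<alpha> (gain \<alpha>) S = - K" "\<forall>x. - K \<le> relative_value \<alpha> (gain \<alpha>) x"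
    using optimal_gain_gain[OF assms] unfolding optimal_gain_def by blast
  from left_null_excess[OF quasiconv[OF assms] continuous_Eh_disc *(2-4)] * that show ?thesis by blast
qed

lemma eventually_discount: "\<forall>\<^sub>F \<alpha> in at_left 1. \<alpha> \<in> {\<alpha>s<..<1}"
  using eventually_at_left_real[OF \<alpha>s(2)] .

text \<open>Strict inequalities at \<open>\<alpha> = 1\<close> survive pointwise convergence, so one
  pair \<open>p\<close>, \<open>a\<close> serves all nearby discount factors.\<close>

lemma eventually_left_null:
  assumes \<gamma>: "(\<gamma> \<longlongrightarrow> g) (at_left 1)" and p: "Eh_disc 1 p < g" and a: "a \<le> p" "g < Eh_disc 1 a"
  shows "\<forall>\<^sub>F \<alpha> in at_left 1. \<alpha> \<in> {\<alpha>s<..<1} \<and> Eh_disc \<alpha> p < \<gamma> \<alpha> \<and> left_null a (excess (Eh_disc \<alpha>) (\<gamma> \<alpha>))"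
proof -
  have "\<forall>\<^sub>F \<alpha> in at_left 1. 0 < \<gamma> \<alpha> - Eh_disc \<alpha> p"
    using p by (intro order_tendstoD(1)[OF tendsto_diff[OF \<gamma> tendsto_Eh_disc]]) simp
  moreover have "\<forall>\<^sub>F \<alpha> in at_left 1. 0 < Eh_disc \<alpha> a - \<gamma> \<alpha>"
    using a by (intro order_tendstoD(1)[OF tendsto_diff[OF tendsto_Eh_disc \<gamma>]]) simp
  ultimately show ?thesis
    using eventually_discount
  proof eventually_elim
    case (elim \<alpha>)
    then have "left_null a (excess (Eh_disc \<alpha>) (\<gamma> \<alpha>))"
      by (intro left_null_excess[where p=p] quasiconv continuous_Eh_disc a) auto
    with elim show ?case by simp
  qed
qed

text \<open>An application of \<open>renewal_stable\<close> against the solution at discount factor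
  1, with an error that tends to zero.\<close>

lemma relative_value_uniform_limit:
  assumes \<gamma>: "(\<gamma> \<longlongrightarrow> g) (at_left 1)" and p: "Eh_disc 1 p < g" and a: "a \<le> p" "g < Eh_disc 1 a"
  shows "uniform_limit {..B} (\<lambda>\<alpha>. relative_value \<alpha> (\<gamma> \<alpha>)) (relative_value 1 g) (at_left 1)"
proof (rule uniform_limitI)
  fix e :: real assume e: "0 < e"
  have one: "1 \<in> {\<alpha>s<..1}" using \<alpha>s by simp
  have \<psi>1: "left_null a (excess (Eh_disc 1) g)"
    using p a by (intro left_null_excess[where p=p] quasiconv one continuous_Eh_disc) auto
  have lb1: "left_bounded (relative_value 1 g)"
    using left_bounded_renewal[OF \<psi>1] by simp
  obtain c where c: "\<And>y. y \<le> B \<Longrightarrow> \<bar>relative_value 1 g y\<bar> \<le> c"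
    using left_boundedD[OF lb1] by metis
  \<comment> \<open>Bounds the change of the source on \<open>{..B}\<close>: up to \<open>a\<close>
    both sources vanish, and between \<open>a\<close> and \<open>B\<close> the distance from
    \<open>y\<close> to \<open>\<mu>\<close> is at most
    \<open>\<bar>a\<bar> + \<bar>B\<bar> + \<mu>\<close>.\<close>
  define \<eta> where "\<eta> \<alpha> = \<bar>1 - \<alpha>\<bar> * (cbar * (\<bar>a\<bar> + \<bar>B\<bar> + \<mu>)) + \<bar>\<gamma> \<alpha> - g\<bar>" for \<alpha>
  have "((\<lambda>\<alpha>. (\<eta> \<alpha> + \<bar>\<alpha> - 1\<bar> * c) * exp (B - a) / (1 - \<theta>))
      \<longlongrightarrow> (\<bar>1 - 1\<bar> * (cbar * (\<bar>a\<bar> + \<bar>B\<bar> + \<mu>)) + \<bar>g - g\<bar> + \<bar>1 - 1\<bar> * c) * exp (B - a) / (1 - \<theta>)) (at_left 1)"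
    unfolding \<eta>_def using \<theta>_less_1 by (intro tendsto_intros \<gamma>) auto
  then have "\<forall>\<^sub>F \<alpha> in at_left 1. (\<eta> \<alpha> + \<bar>\<alpha> - 1\<bar> * c) * exp (B - a) / (1 - \<theta>) < e"
    using e by (intro order_tendstoD(2)) auto
  then show "\<forall>\<^sub>F \<alpha> in at_left 1. \<forall>x\<in>{..B}. dist (relative_value \<alpha> (\<gamma> \<alpha>) x) (relative_value 1 g x) < e"
    using eventually_left_null[OF assms]
  proof (eventually_elim, intro ballI)
    fix \<alpha> x assume less: "(\<eta> \<alpha> + \<bar>\<alpha> - 1\<bar> * c) * exp (B - a) / (1 - \<theta>) < e" and x: "x \<in> {..B}"
      and \<alpha>: "\<alpha> \<in> {\<alpha>s<..<1} \<and> Eh_disc \<alpha> p < \<gamma> \<alpha> \<and> left_null a (excess (Eh_disc \<alpha>) (\<gamma> \<alpha>))"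
    have "\<bar>relative_value \<alpha> (\<gamma> \<alpha>) x - relative_value 1 g x\<bar> \<le> (\<eta> \<alpha> + \<bar>\<alpha> - 1\<bar> * c) * exp (B - a) / (1 - \<theta>)"
    proof (rule renewal_stable[OF _ \<psi>1])
      show "\<bar>excess (Eh_disc \<alpha>) (\<gamma> \<alpha>) y - excess (Eh_disc 1) g y\<bar> \<le> \<eta> \<alpha>" if y: "y \<le> B" for y
      proof (cases "y \<le> a")
        case True
        then show ?thesis using \<alpha> \<psi>1 cbar_pos \<mu>_nonneg by (simp add: left_null_def \<eta>_def)
      next
        case False
        have "\<bar>excess (Eh_disc \<alpha>) (\<gamma> \<alpha>) y - excess (Eh_disc 1) g y\<bar>
            \<le> \<bar>Eh_disc \<alpha> y - Eh_disc 1 y\<bar> + \<bar>\<gamma> \<alpha> - g\<bar>"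
          using \<alpha> p one by (intro excess_diff_le[where p=p] quasiconv) auto
        also have "Eh_disc \<alpha> y - Eh_disc 1 y = (1 - \<alpha>) * (cbar * (y - \<mu>))"
          by (simp add: Eh_disc_eq)
        also have "\<bar>\<dots>\<bar> = \<bar>1 - \<alpha>\<bar> * (cbar * \<bar>y - \<mu>\<bar>)" using cbar_pos by (simp add: abs_mult)
        also have "\<dots> \<le> \<bar>1 - \<alpha>\<bar> * (cbar * (\<bar>a\<bar> + \<bar>B\<bar> + \<mu>))"
          using False y cbar_pos \<mu>_nonneg by (intro mult_left_mono) auto
        finally show ?thesis by (simp add: \<eta>_def)
      qed
    qed (use \<alpha> \<alpha>s x c in auto)
    with less show "dist (relative_value \<alpha> (\<gamma> \<alpha>) x) (relative_value 1 g x) < e"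
      by (simp add: dist_real_def)
  qed
qed

lemma gain_1E:
  obtains p a S where "\<And>y. Eh_disc 1 p \<le> Eh_disc 1 y" "Eh_disc 1 p < gain 1"
    "a \<le> p" "gain 1 + 1 < Eh_disc 1 a"
    "relative_value 1 (gain 1) S = - K" "\<And>x. - K \<le> relative_value 1 (gain 1) x"
proof -
  have one: "1 \<in> {\<alpha>s<..1}" using \<alpha>s by simp
  obtain p a S where *: "\<And>y. Eh_disc 1 p \<le> Eh_disc 1 y" "Eh_disc 1 p \<le> gain 1"
    "a \<le> p" "left_null a (excess (Eh_disc 1) (gain 1))"
    "relative_value 1 (gain 1) S = - K" "\<And>x. - K \<le> relative_value 1 (gain 1) x"
    using gainE[OF one] by metis
  \<comment> \<open>Equality would make the source, hence the solution, nonnegative, against the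
    value \<open>- K\<close> at \<open>S\<close>.\<close>
  have "Eh_disc 1 p \<noteq> gain 1"
  proof
    assume eq: "Eh_disc 1 p = gain 1"
    have "relative_value 1 (gain 1) S \<ge> - 0"
    proof (rule renewal_ge_if_nonneg_right[OF *(4), where b=a])
      show "relative_value 1 (gain 1) y \<ge> - 0" if "y \<le> a" for y
        using left_null_renewal[OF *(4), of 1] that by (simp add: left_null_def)
      show "excess (Eh_disc 1) (gain 1) y \<ge> 0" for y
        using *(1)[of y] eq by (simp add: excess_def)
    qed auto
    with *(5) K_pos show False by simp
  qed
  moreover obtain b where b: "\<And>x. \<bar>x\<bar> \<ge> b \<Longrightarrow> mean_cost x > gain 1 + 1" using mean_cost_large by metis
  \<comment> \<open>Far enough left for coercivity to leave room of 1 above the gain, so that higher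
    levels can be tested too.\<close>
  define a' where "a' = min p (- \<bar>b\<bar>)"
  have "gain 1 + 1 < Eh_disc 1 a'"
  proof -
    have "b \<le> \<bar>a'\<bar>" by (simp add: a'_def)
    moreover have "0 \<le> cbar * \<mu>" using cbar_pos \<mu>_nonneg by simp
    ultimately show ?thesis using b[of a'] by (simp add: Eh_disc_eq)
  qed
  ultimately show ?thesis using that[of p a' S] * by (auto simp: a'_def)
qed

section \<open>Convergence of the gains and of the relative values\<close>

lemma left_null_excess_1:
  assumes "Eh_disc 1 p \<le> g" "a \<le> p" "g < Eh_disc 1 a"
  shows "left_null a (excess (Eh_disc 1) g)"
  using assms \<alpha>s by (intro left_null_excess[where p=p] quasiconv continuous_Eh_disc) auto

text \<open>Relative values decrease in the level, so a gain of at least \<open>l\<close> would also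
  have a value below \<open>- K\<close>.\<close>

lemma gain_le_if_relative_value_less:
  assumes \<alpha>: "\<alpha> \<in> {\<alpha>s<..1}" and \<psi>: "left_null a (excess (Eh_disc \<alpha>) l)" and p: "Eh_disc \<alpha> p \<le> l"
    and less: "relative_value \<alpha> l x < - K"
  shows "gain \<alpha> < l"
proof (rule ccontr)
  assume "\<not> gain \<alpha> < l"
  obtain a' where a': "left_null a' (excess (Eh_disc \<alpha>) (gain \<alpha>))" "- K \<le> relative_value \<alpha> (gain \<alpha>) x"
    using gainE[OF \<alpha>] by metis
  have "relative_value \<alpha> (gain \<alpha>) x \<le> relative_value \<alpha> l x"
    using \<alpha> \<alpha>s \<open>\<not> gain \<alpha> < l\<close>
    by (intro renewal_mono[of "min a a'"] left_null_mono[OF \<psi>] left_null_mono[OF a'(1)]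
        excess_antimono[OF quasiconv[OF \<alpha>] p]) auto
  with a'(2) less show False by simp
qed

text \<open>With a gain of at most \<open>l\<close>, monotonicity would put the value of level
  \<open>l\<close> at \<open>S\<close> at or below \<open>- K\<close>.\<close>

lemma gain_greater_if_relative_value_greater:
  assumes \<alpha>: "\<alpha> \<in> {\<alpha>s<..1}" and \<psi>: "left_null a (excess (Eh_disc \<alpha>) l)"
    and greater: "\<And>x. - K < relative_value \<alpha> l x"
  shows "l < gain \<alpha>"
proof (rule ccontr)
  assume "\<not> l < gain \<alpha>"
  obtain p a' S where a': "Eh_disc \<alpha> p \<le> gain \<alpha>" "left_null a' (excess (Eh_disc \<alpha>) (gain \<alpha>))"
      "relative_value \<alpha> (gain \<alpha>) S = - K"
    using gainE[OF \<alpha>] by metis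
  have "relative_value \<alpha> l S \<le> relative_value \<alpha> (gain \<alpha>) S"
    using \<alpha> \<alpha>s \<open>\<not> l < gain \<alpha>\<close>
    by (intro renewal_mono[of "min a a'"] left_null_mono[OF \<psi>] left_null_mono[OF a'(2)]
        excess_antimono[OF quasiconv[OF \<alpha>] a'(1)]) auto
  with a'(3) greater[of S] show False by simp
qed

text \<open>A level slightly above or below \<open>gain 1\<close> has minimum strictly below or
  above \<open>- K\<close>. Uniform convergence preserves this for discount factors near 1 and
  thereby locates the gain.\<close>

lemma tendsto_gain: "(gain \<longlongrightarrow> gain 1) (at_left 1)"
proof (rule order_tendstoI)
  obtain p a S where p: "Eh_disc 1 p < gain 1" and a: "a \<le> p" "gain 1 + 1 < Eh_disc 1 a"
    and S: "relative_value 1 (gain 1) S = - K" and ge: "\<And>x. - K \<le> relative_value 1 (gain 1) x"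
    using gain_1E by metis
  have one: "1 \<in> {\<alpha>s<..1}" using \<alpha>s by simp
  have \<psi>1: "left_null a (excess (Eh_disc 1) (gain 1))"
    using p a by (intro left_null_excess_1[of p]) auto
  {
    fix l0 assume "gain 1 < l0"
    \<comment> \<open>The cap keeps the level below \<open>Eh_disc 1 a\<close>.\<close>
    define l where "l = min l0 (gain 1 + 1)"
    have l: "gain 1 < l" "l \<le> l0" "l < Eh_disc 1 a" "Eh_disc 1 p < l"
      using \<open>gain 1 < l0\<close> p a by (auto simp: l_def)
    have \<psi>: "left_null a (excess (Eh_disc 1) l)" using l a by (intro left_null_excess_1[of p]) auto
    have "\<exists>y\<le>S. Eh_disc 1 y \<le> gain 1"
      using relative_value_eq_0[OF _ _ \<psi>1, of S] S K_pos by auto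
    then have "relative_value 1 l S \<le> - K - (l - gain 1)"
      using relative_value_strict_antimono[OF _ _ quasiconv[OF one] _ \<psi>1 \<psi>, of p S] p l S by simp
    then have "relative_value 1 l S < - K" using l by simp
    moreover have "((\<lambda>\<alpha>. relative_value \<alpha> l S) \<longlongrightarrow> relative_value 1 l S) (at_left 1)"
      by (rule tendsto_uniform_limitI[OF relative_value_uniform_limit[OF tendsto_const l(4) a(1) l(3), of S]]) simp
    ultimately have "\<forall>\<^sub>F \<alpha> in at_left 1. relative_value \<alpha> l S < - K"
      by (intro order_tendstoD(2))
    then have "\<forall>\<^sub>F \<alpha> in at_left 1. gain \<alpha> < l"
      using eventually_left_null[OF tendsto_const l(4) a(1) l(3)]
      by eventually_elim (rule gain_le_if_relative_value_less[of _ a l p S]; simp)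
    then show "\<forall>\<^sub>F \<alpha> in at_left 1. gain \<alpha> < l0"
      by eventually_elim (use l in simp)
  }
  {
    fix l0 assume "l0 < gain 1"
    have mid: "(Eh_disc 1 p + gain 1) / 2 < gain 1" "Eh_disc 1 p < (Eh_disc 1 p + gain 1) / 2"
      using p by (simp_all add: field_simps)
    \<comment> \<open>The midpoint keeps the level above the minimum of
      \<open>Eh_disc 1\<close>.\<close>
    define l where "l = max l0 ((Eh_disc 1 p + gain 1) / 2)"
    have l: "l < gain 1" "l0 \<le> l" "l < Eh_disc 1 a" "Eh_disc 1 p < l"
      using \<open>l0 < gain 1\<close> p a mid by (auto simp: l_def less_max_iff_disj)
    have \<psi>: "left_null a (excess (Eh_disc 1) l)" using l a by (intro left_null_excess_1[of p]) auto
    \<comment> \<open>The term \<open>K\<close> covers states left of the reorder point, where the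
      relative value is zero.\<close>
    define d where "d = min (gain 1 - l) K"
    have d: "0 < d" "d \<le> K" using l K_pos by (auto simp: d_def)
    have lower: "- K + d \<le> relative_value 1 l x" for x
    proof (cases "\<exists>y\<le>x. Eh_disc 1 y \<le> l")
      case True
      then show ?thesis
        using relative_value_strict_antimono[OF _ _ quasiconv[OF one] _ \<psi> \<psi>1 _ True, of p] l ge[of x]
        by (simp add: d_def)
    next
      case False
      with relative_value_eq_0[OF _ _ \<psi>, of x] d show ?thesis by simp
    qed
    \<comment> \<open>Uniform convergence acts up to \<open>B\<close>; beyond it quasiconvexity
      keeps the source nonnegative.\<close>
    obtain B where B: "B \<ge> p" "Eh_disc 1 B > l"
      using Eh_disc_large[of 1] by (metis order_refl)
    have "\<forall>\<^sub>F \<alpha> in at_left 1. \<forall>x\<in>{..B}. dist (relative_value \<alpha> l x) (relative_value 1 l x) < d / 2"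
      using relative_value_uniform_limit[OF tendsto_const l(4) a(1) l(3), of B] d
      by (intro uniform_limitD) auto
    moreover have "\<forall>\<^sub>F \<alpha> in at_left 1. l < Eh_disc \<alpha> B"
      by (rule order_tendstoD(1)[OF tendsto_Eh_disc B(2)])
    ultimately have "\<forall>\<^sub>F \<alpha> in at_left 1. l < gain \<alpha>"
      using eventually_left_null[OF tendsto_const l(4) a(1) l(3)]
    proof eventually_elim
      case (elim \<alpha>)
      then have \<alpha>: "\<alpha> \<in> {\<alpha>s<..1}" "0 \<le> \<alpha>" "\<alpha> \<le> 1" and \<psi>\<alpha>: "left_null a (excess (Eh_disc \<alpha>) l)"
        and p\<alpha>: "Eh_disc \<alpha> p < l"
        using \<alpha>s by auto
      show ?case
      proof (rule gain_greater_if_relative_value_greater[OF \<alpha>(1) \<psi>\<alpha>])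
        fix x
        have "- (K - d / 2) \<le> relative_value \<alpha> l x"
        proof (rule renewal_ge_if_nonneg_right[OF \<psi>\<alpha> \<alpha>(2,3)])
          fix y
          show "- (K - d / 2) \<le> relative_value \<alpha> l y" if "y \<le> B"
          proof -
            have "dist (relative_value \<alpha> l y) (relative_value 1 l y) < d / 2"
              using elim(1) that by simp
            then have "relative_value 1 l y - relative_value \<alpha> l y < d / 2"
              unfolding dist_real_def by linarith
            with lower[of y] show ?thesis by linarith
          qed
          show "0 \<le> excess (Eh_disc \<alpha>) l y" if "B < y"
            using quasiconvex_between[OF quasiconv[OF \<alpha>(1)], of p B y] that B p\<alpha> elim(2)
            by (auto simp: excess_def)
        qed (use d in simp)
        with d show "- K < relative_value \<alpha> l x" by simp
      qed
    qed
    then show "\<forall>\<^sub>F \<alpha> in at_left 1. l0 < gain \<alpha>"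
      by eventually_elim (use l in simp)
  }
qed

text \<open>Minimizers for all discount factors near 1 lie in one compact interval, so the
  subtracted minima converge along with the functions. The real \<open>r\<close> records that
  \<open>u_disc\<close> is finite.\<close>

lemma u_disc_locally_uniform_limit:
  "\<exists>U. continuous_on UNIV U \<and>
    (\<forall>B. \<forall>e>0. \<forall>\<^sub>F \<alpha> in at_left 1. \<forall>x\<le>B. \<exists>r. u_disc \<alpha> x = ereal r \<and> \<bar>r - U x\<bar> < e)"
proof -
  obtain p a where p: "Eh_disc 1 p < gain 1" and a: "a \<le> p" "gain 1 + 1 < Eh_disc 1 a"
    using gain_1E by metis
  have a': "gain 1 < Eh_disc 1 a" using a by simp
  have one: "1 \<in> {\<alpha>s<..1}" using \<alpha>s by simp
  have \<psi>1: "left_null a (excess (Eh_disc 1) (gain 1))"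
    using p a by (intro left_null_excess_1[of p]) auto
  obtain b where b: "\<And>x. \<bar>x\<bar> \<ge> b \<Longrightarrow> mean_cost x > gain 1 + 1 + cbar * \<bar>p\<bar>"
    using mean_cost_large by metis
  \<comment> \<open>The margin of 1 in the choice of \<open>b\<close> lets the same
    \<open>B0\<close> work for every gain below \<open>gain 1 + 1\<close>.\<close>
  define B0 where "B0 = max p \<bar>b\<bar>"
  have B0: "p \<le> B0" "\<And>y. B0 < y \<Longrightarrow> gain 1 + 1 + cbar * \<bar>p\<bar> \<le> mean_cost y"
    using b by (auto simp: B0_def intro!: less_imp_le)
  define w where "w \<alpha> x = relative_value \<alpha> (gain \<alpha>) x - cbar * x" for \<alpha> x
  have "gain 1 + cbar * \<bar>p\<bar> \<le> mean_cost y" if "B0 < y" for y using B0(2)[OF that] by simp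
  then obtain z1 where z1: "z1 \<in> {a..B0}" "\<And>y. w 1 z1 \<le> w 1 y"
    using relative_value_attains_inf[OF zero_le_one order_refl \<psi>1 quasiconv[OF one] less_imp_le[OF p] a(1) B0(1)]
    unfolding w_def by blast
  define U where "U x = w 1 x - w 1 z1" for x
  show ?thesis
  proof (intro exI[of _ U] conjI allI impI)
    show "continuous_on UNIV U"
      using left_null_renewal[OF \<psi>1, of 1] unfolding U_def w_def left_null_def
      by (intro continuous_intros) auto
    fix B e :: real assume e: "0 < e"
    have "\<forall>\<^sub>F \<alpha> in at_left 1. \<forall>x\<in>{..max B B0}.
        dist (relative_value \<alpha> (gain \<alpha>) x) (relative_value 1 (gain 1) x) < e / 2"
      using relative_value_uniform_limit[OF tendsto_gain p a(1) a'] e by (intro uniform_limitD) auto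
    moreover have "\<forall>\<^sub>F \<alpha> in at_left 1. gain \<alpha> < gain 1 + 1"
      by (rule order_tendstoD(2)[OF tendsto_gain]) simp
    ultimately show "\<forall>\<^sub>F \<alpha> in at_left 1. \<forall>x\<le>B. \<exists>r. u_disc \<alpha> x = ereal r \<and> \<bar>r - U x\<bar> < e"
      using eventually_left_null[OF tendsto_gain p a(1) a']
    proof eventually_elim
      case (elim \<alpha>)
      then have \<alpha>: "\<alpha> \<in> {\<alpha>s<..1}" "0 \<le> \<alpha>" "\<alpha> < 1" and \<psi>\<alpha>: "left_null a (excess (Eh_disc \<alpha>) (gain \<alpha>))"
        and p\<alpha>: "Eh_disc \<alpha> p \<le> gain \<alpha>"
        using \<alpha>s by auto
      have near: "\<bar>w \<alpha> x - w 1 x\<bar> < e / 2" if "x \<le> max B B0" for x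
        using elim(1) that by (simp add: w_def dist_real_def)
      have "gain \<alpha> + cbar * \<bar>p\<bar> \<le> mean_cost y" if "B0 < y" for y
        using B0(2)[OF that] elim(2) by simp
      then obtain z where z: "z \<in> {a..B0}" "\<And>y. w \<alpha> z \<le> w \<alpha> y"
        using relative_value_attains_inf[OF \<alpha>(2) less_imp_le[OF \<alpha>(3)] \<psi>\<alpha> quasiconv[OF \<alpha>(1)] p\<alpha> a(1) B0(1)]
        unfolding w_def by blast
      obtain p' a' S where lev: "\<And>y. Eh_disc \<alpha> p' \<le> Eh_disc \<alpha> y" "Eh_disc \<alpha> p' \<le> gain \<alpha>"
        "a' \<le> p'" "gain \<alpha> < Eh_disc \<alpha> a'"
        "relative_value \<alpha> (gain \<alpha>) S = - K" "\<And>x. - K \<le> relative_value \<alpha> (gain \<alpha>) x"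
        using gainE[OF \<alpha>(1)] by metis
      interpret optimal_level M D K cbar h \<alpha> p' a' "gain \<alpha>" S
        by unfold_locales (use \<alpha> lev quasiconv[OF \<alpha>(1)] in auto)
      have ud: "u_disc \<alpha> x = ereal (w \<alpha> x - w \<alpha> z)" for x
        using u_disc_eq[of z x] z(2) by (simp add: w_def)
      show ?case
      proof (intro allI impI)
        fix x assume x: "x \<le> B"
        \<comment> \<open>Each function is tested at the minimizer of the other.\<close>
        have "\<bar>w \<alpha> z - w 1 z1\<bar> < e / 2"
        proof -
          have "z \<le> max B B0" "z1 \<le> max B B0" using z(1) z1(1) by auto
          from near[OF this(1)] near[OF this(2)] z(2)[of z1] z1(2)[of z] show ?thesis by linarith
        qed
        moreover have "\<bar>w \<alpha> x - w 1 x\<bar> < e / 2" by (rule near) (use x in simp)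
        ultimately have "\<bar>(w \<alpha> x - w \<alpha> z) - U x\<bar> < e"
          unfolding U_def by linarith
        with ud show "\<exists>r. u_disc \<alpha> x = ereal r \<and> \<bar>r - U x\<bar> < e" by blast
      qed
    qed
  qed
qed

text \<open>Locally uniform convergence to a continuous function gives joint convergence, so every
  lower limit in the definition of \<open>u\<close> has the same value.\<close>

lemma u_disc_tendsto_u:
  "(\<forall>x. ((\<lambda>\<alpha>. u_disc \<alpha> x) \<longlongrightarrow> u x) (at_left 1)) \<and> (\<forall>x. \<bar>u x\<bar> \<noteq> \<infinity>) \<and> continuous_on UNIV u"
proof -
  obtain U where U: "continuous_on UNIV U"
    and lim': "\<forall>B. \<forall>e>0. \<forall>\<^sub>F \<alpha> in at_left 1. \<forall>x\<le>B. \<exists>r. u_disc \<alpha> x = ereal r \<and> \<bar>r - U x\<bar> < e"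
    using u_disc_locally_uniform_limit by blast
  note lim = lim'[rule_format]
  \<comment> \<open>A general filter covers sequences as well as the limit from the left at fixed
    \<open>x\<close>.\<close>
  have joint: "((\<lambda>i. u_disc (\<alpha> i) (y i)) \<longlongrightarrow> ereal (U x)) F"
    if \<alpha>: "filterlim \<alpha> (at_left 1) F" and y: "(y \<longlongrightarrow> x) F" for \<alpha> y :: "'i \<Rightarrow> real" and x F
  proof -
    have "((\<lambda>i. real_of_ereal (u_disc (\<alpha> i) (y i))) \<longlongrightarrow> U x) F"
    proof (rule tendstoI)
      fix e :: real assume e: "0 < e"
      have "((\<lambda>i. U (y i)) \<longlongrightarrow> U x) F"
        using U y by (intro continuous_on_tendsto_compose[OF U]) auto
      then have "\<forall>\<^sub>F i in F. dist (U (y i)) (U x) < e / 2" using e by (intro tendstoD) auto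
      moreover have "\<forall>\<^sub>F i in F. \<forall>z\<le>x + 1. \<exists>r. u_disc (\<alpha> i) z = ereal r \<and> \<bar>r - U z\<bar> < e / 2"
        using eventually_compose_filterlim[OF lim[of "e / 2" "x + 1"] \<alpha>] e by simp
      moreover have "\<forall>\<^sub>F i in F. y i < x + 1" using y by (rule order_tendstoD) simp
      ultimately show "\<forall>\<^sub>F i in F. dist (real_of_ereal (u_disc (\<alpha> i) (y i))) (U x) < e"
      proof eventually_elim
        case (elim i)
        then obtain r where "u_disc (\<alpha> i) (y i) = ereal r" "\<bar>r - U (y i)\<bar> < e / 2" by (meson less_imp_le)
        moreover from this(2) elim(1) have "\<bar>r - U x\<bar> < e" unfolding dist_real_def by linarith
        ultimately show ?case by (simp add: dist_real_def)
      qed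
    qed
    then have "((\<lambda>i. ereal (real_of_ereal (u_disc (\<alpha> i) (y i)))) \<longlongrightarrow> ereal (U x)) F" by simp
    moreover have "\<forall>\<^sub>F i in F. ereal (real_of_ereal (u_disc (\<alpha> i) (y i))) = u_disc (\<alpha> i) (y i)"
    proof -
      have "\<forall>\<^sub>F i in F. \<forall>z\<le>x + 1. \<exists>r. u_disc (\<alpha> i) z = ereal r \<and> \<bar>r - U z\<bar> < 1"
        using eventually_compose_filterlim[OF lim[of 1 "x + 1"] \<alpha>] by simp
      moreover have "\<forall>\<^sub>F i in F. y i < x + 1" using y by (rule order_tendstoD) simp
      ultimately show ?thesis by eventually_elim (metis less_imp_le real_of_ereal.simps(1))
    qed
    ultimately show ?thesis by (rule Lim_transform_eventually)
  qed
  have u: "u x = ereal (U x)" for x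
  proof -
    let ?A = "{(\<alpha>, y). (\<forall>n. \<alpha> n \<in> {0..<1}) \<and> incseq \<alpha> \<and> \<alpha> \<longlonglongrightarrow> (1::real) \<and> y \<longlonglongrightarrow> x}"
    have eq: "liminf (\<lambda>n. u_disc (\<alpha> n) (y n)) = ereal (U x)" if "(\<alpha>, y) \<in> ?A" for \<alpha> y
    proof (rule lim_imp_Liminf)
      have "filterlim \<alpha> (at_left 1) sequentially"
        using that by (auto simp: filterlim_at intro!: always_eventually) (metis less_irrefl)
      with that show "(\<lambda>n. u_disc (\<alpha> n) (y n)) \<longlonglongrightarrow> ereal (U x)" by (intro joint) auto
    qed simp
    \<comment> \<open>This sequence, with constant second component, makes the index set of the
      infimum nonempty.\<close>
    have "(\<lambda>n. 1 - inverse (real (Suc n))) \<longlonglongrightarrow> 1 - 0"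
      by (intro tendsto_diff tendsto_const LIMSEQ_inverse_real_of_nat)
    moreover have "incseq (\<lambda>n. 1 - inverse (real (Suc n)))"
      by (auto simp: incseq_def field_simps)
    ultimately have "(\<lambda>n. 1 - inverse (real (Suc n)), \<lambda>_. x) \<in> ?A"
      by (auto simp: field_simps)
    then have ne: "?A \<noteq> {}" unfolding ex_in_conv[symmetric] by (rule exI)
    show ?thesis
      unfolding u_def
    proof (rule INF_eq_const[OF ne])
      fix q assume "q \<in> ?A"
      then have "(fst q, snd q) \<in> ?A" by simp
      from eq[OF this] show "(case q of (\<alpha>, y) \<Rightarrow> liminf (\<lambda>n. u_disc (\<alpha> n) (y n))) = ereal (U x)"
        by (simp add: case_prod_beta)
    qed
  qed
  have "((\<lambda>\<alpha>. u_disc \<alpha> x) \<longlongrightarrow> u x) (at_left 1)" for x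
    unfolding u by (rule joint) (auto simp: filterlim_ident)
  moreover have "continuous_on UNIV u"
    unfolding u[abs_def] by (rule continuous_on_ereal[OF U])
  ultimately show ?thesis by (auto simp: u)
qed

end

theorem theorem7p1:
  fixes M :: "'w measure" and D :: "nat \<Rightarrow> 'w \<Rightarrow> real"
    and K cbar :: real and h :: "real \<Rightarrow> real" and \<alpha>s :: real
  assumes model: "inventory_model M D K cbar h"
    and \<alpha>s: "0 \<le> \<alpha>s" "\<alpha>s < 1"
    and quasiconv: "\<And>\<alpha>. \<alpha> \<in> {\<alpha>s<..1} \<Longrightarrow> quasiconvex (inventory_model.Eh_disc M D cbar h \<alpha>)"
    and limit_at_bot: "\<And>\<alpha>. \<alpha> \<in> {\<alpha>s<..1} \<Longrightarrow>
      \<exists>L. ((\<lambda>x. ereal (inventory_model.Eh_disc M D cbar h \<alpha> x)) \<longlongrightarrow> L) at_bot \<and>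
          L > ereal K + (INF x. ereal (inventory_model.Eh_disc M D cbar h \<alpha> x))"
    and decreasing: "strict_antimono_on {..inventory_model.x_min M D cbar h 1}
      (inventory_model.Eh_disc M D cbar h 1)"
  shows "(\<forall>x. ((\<lambda>\<alpha>. inventory_model.u_disc M D K cbar h \<alpha> x)
             \<longlongrightarrow> inventory_model.u M D K cbar h x) (at_left 1))
       \<and> (\<forall>x. \<bar>inventory_model.u M D K cbar h x\<bar> \<noteq> \<infinity>)
       \<and> continuous_on UNIV (inventory_model.u M D K cbar h)"
proof -
  interpret inventory_model M D K cbar h by (rule model)
  interpret quasiconvex_inventory M D K cbar h \<alpha>s
    by unfold_locales (fact \<alpha>s quasiconv limit_at_bot)+
  show ?thesis by (rule u_disc_tendsto_u)
qed

end
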